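(* Let $k=k(n)$ be any integer-valued function such that $k(n)\le n/(4\log n)$. Then $\mathrm{ERPHP}^k_{n,k-1}$ can be refuted in Sherali-Adams resolution (SAR) in size $O(k^{k+2}n^k)$, and any SAR refutation of it requires size $\Omega\!\left(\dfrac{n^{k}}{(4k\log n)^k}\right)$.
   Context: $\log$ is the binary logarithm; $[n]=\{1,\dots,n\}$, $[a,b]=\{a,\dots,b\}$. The 3-CNF formula $\mathrm{ERPHP}^k_{n,k-1}$ has variables $p_{u,v}$ ($u\in[k],v\in[n]$), $y_{u,v}$ ($u\in[k]$, $v\in[2,n-2]$), $r_v$ ($v\in[n]$), $r_{v,v'}$ ($v\ne v'\in[n]$), $q_{v,w}$ ($v\in[n],w\in[k-1]$), $z_{v,w}$ ($v\in[n]$, $w\in[k-3]$), and clauses: $p_{u,1}\lor p_{u,2}\lor y_{u,2}$ ($u\in[k]$); $\bar y_{u,v}\lor p_{u,v+1}\lor y_{u,v+1}$ ($u\in[k],v\in[2,n-3]$); $\bar y_{u,n-2}\lor p_{u,n-1}\lor p_{u,n}$ ($u\in[k]$); $\bar r_v\lor q_{v,1}\lor z_{v,1}$ ($v\in[n]$); $\bar z_{v,w}\lor q_{v,w+1}\lor z_{v,w+1}$ ($v\in[n],w\in[k-4]$); $\bar z_{v,k-3}\lor q_{v,k-2}\lor q_{v,k-1}$ ($v\in[n]$); $\bar p_{u,v}\lor\bar p_{u',v}$ ($u\ne u'\in[k],v\in[n]$); $\bar p_{u,v}\lor r_v$ ($u\in[k],v\in[n]$); $\bar r_v\lor\bar r_{v'}\lor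 r_{v,v'}$ ($v\ne v'\in[n]$); $\bar r_{v,v'}\lor\bar q_{v,w}\lor\bar q_{v',w}$ ($v\ne v'\in[n],w\in[k-1]$). SAR: real variables are the formula's variables $x$ together with independent twin variables $\bar x$; a clause $\bigvee_{i\in I}x_i\lor\bigvee_{j\in J}\bar x_j$ is encoded as $\sum_{i\in I}x_i+\sum_{j\in J}\bar x_j-1\ge0$. An SAR refutation is an expression $\sum_{t=1}^{\tau}\alpha_t\prod_{i\in I_t}y_i\prod_{j\in J_t}(1-y_j)\,p_t$ (the $y$'s ranging over variables and twins) with reals $\alpha_t\ge0$, each $p_t$ being the polynomial of an encoded clause, an axiom $y^2-y$ or $y-y^2$, a complementarity axiom $1-x-\bar x$ or $-1+x+\bar x$, or the constant $1$, which expands to $-1$. Its size is the sum over $t$ of the number of terms of the polynomial to which $\prod_{i\in I_t}y_i\prod_{j\in J_t}(1-y_j)p_t$ expands. *)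

theory Defs
  imports Complex_Main "HOL-Library.Poly_Mapping"
begin

text \<open>A literal doubles as a real variable of Sherali-Adams resolution: \<open>Pos x\<close> is the variable
  \<open>x\<close> itself and \<open>Neg x\<close> is its independent twin. No relation between the two is built into the
  polynomial ring; it is only available through the complementarity axioms.\<close>

datatype 'a literal = Pos (lit_var: 'a) | Neg (lit_var: 'a)

type_synonym 'a clause = "'a literal set"

type_synonym 'a cnf = "'a clause set"

definition vars_of :: "'a cnf \<Rightarrow> 'a set" where
  "vars_of F = (\<Union>C\<in>F. lit_var ` C)"

definition literals_of :: "'a cnf \<Rightarrow> 'a literal set" where
  "literals_of F = Pos ` vars_of F \<union> Neg ` vars_of F"

text \<open>Real polynomials in the literals: a monomial is a finitely supported exponent function, and
  a polynomial is a finitely supported function from monomials to coefficients, with the ring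
  structure of \<open>Poly_Mapping\<close>. They are not identified modulo \<open>y\<^sup>2 = y\<close>.\<close>

type_synonym 'a rpoly = "('a literal \<Rightarrow>\<^sub>0 nat) \<Rightarrow>\<^sub>0 real"

definition rvar :: "'a literal \<Rightarrow> 'a rpoly" where
  "rvar y = Poly_Mapping.single (Poly_Mapping.single y 1) 1"

definition rconst :: "real \<Rightarrow> 'a rpoly" where
  "rconst a = Poly_Mapping.single 0 a"

definition num_terms :: "'a rpoly \<Rightarrow> nat" where
  "num_terms p = card (Poly_Mapping.keys p)"

definition clause_poly :: "'a clause \<Rightarrow> 'a rpoly" where
  "clause_poly C = (\<Sum>l\<in>C. rvar l) - 1"

inductive_set sar_axioms :: "'a cnf \<Rightarrow> 'a rpoly set" for F :: "'a cnf" where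
  clause: "C \<in> F \<Longrightarrow> clause_poly C \<in> sar_axioms F"
| bool_lower: "y \<in> literals_of F \<Longrightarrow> rvar y ^ 2 - rvar y \<in> sar_axioms F"
| bool_upper: "y \<in> literals_of F \<Longrightarrow> rvar y - rvar y ^ 2 \<in> sar_axioms F"
| compl_lower: "x \<in> vars_of F \<Longrightarrow> 1 - rvar (Pos x) - rvar (Neg x) \<in> sar_axioms F"
| compl_upper: "x \<in> vars_of F \<Longrightarrow> - 1 + rvar (Pos x) + rvar (Neg x) \<in> sar_axioms F"
| one: "1 \<in> sar_axioms F"

record 'a sar_term =
  coefficient :: real
  factors :: "'a literal set"
  cofactors :: "'a literal set"
  base :: "'a rpoly"

definition term_poly :: "'a sar_term \<Rightarrow> 'a rpoly" where
  "term_poly t = (\<Prod>y\<in>factors t. rvar y) * (\<Prod>y\<in>cofactors t. 1 - rvar y) * base t"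

definition sar_refutation :: "'a cnf \<Rightarrow> 'a sar_term list \<Rightarrow> bool" where
  "sar_refutation F \<pi> \<longleftrightarrow>
     (\<forall>t\<in>set \<pi>. coefficient t \<ge> 0 \<and>
        finite (factors t) \<and> factors t \<subseteq> literals_of F \<and>
        finite (cofactors t) \<and> cofactors t \<subseteq> literals_of F \<and>
        base t \<in> sar_axioms F) \<and>
     (\<Sum>t\<leftarrow>\<pi>. rconst (coefficient t) * term_poly t) = - 1"

definition sar_size :: "'a sar_term list \<Rightarrow> nat" where
  "sar_size \<pi> = (\<Sum>t\<leftarrow>\<pi>. num_terms (term_poly t))"

text \<open>\<open>RR v v'\<close> is the doubly indexed variable written \<open>r\<close> with subscripts \<open>v\<close>, \<open>v'\<close>; ordered
  pairs index distinct variables.\<close>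

datatype erphp_var =
  P nat nat | Y nat nat | R nat | RR nat nat | Q nat nat | Z nat nat

text \<open>The formula with \<open>k\<close> pigeons, \<open>n\<close> resting places and \<open>k - 1\<close> holes. The index ranges, and
  the truncated subtractions in them, are meaningful for \<open>k \<ge> 4\<close> and \<open>n \<ge> 4\<close>, where the chains of
  extension variables \<open>Y\<close> and \<open>Z\<close> are nonempty.\<close>

definition erphp :: "nat \<Rightarrow> nat \<Rightarrow> erphp_var cnf" where
  "erphp k n =
     {{Pos (P u 1), Pos (P u 2), Pos (Y u 2)} | u. u \<in> {1..k}} \<union>
     {{Neg (Y u v), Pos (P u (v + 1)), Pos (Y u (v + 1))} | u v. u \<in> {1..k} \<and> v \<in> {2..n - 3}} \<union>
     {{Neg (Y u (n - 2)), Pos (P u (n - 1)), Pos (P u n)} | u. u \<in> {1..k}} \<union>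
     {{Neg (R v), Pos (Q v 1), Pos (Z v 1)} | v. v \<in> {1..n}} \<union>
     {{Neg (Z v w), Pos (Q v (w + 1)), Pos (Z v (w + 1))} | v w. v \<in> {1..n} \<and> w \<in> {1..k - 4}} \<union>
     {{Neg (Z v (k - 3)), Pos (Q v (k - 2)), Pos (Q v (k - 1))} | v. v \<in> {1..n}} \<union>
     {{Neg (P u v), Neg (P u' v)} | u u' v. u \<in> {1..k} \<and> u' \<in> {1..k} \<and> u \<noteq> u' \<and> v \<in> {1..n}} \<union>
     {{Neg (P u v), Pos (R v)} | u v. u \<in> {1..k} \<and> v \<in> {1..n}} \<union>
     {{Neg (R v), Neg (R v'), Pos (RR v v')} | v v'. v \<in> {1..n} \<and> v' \<in> {1..n} \<and> v \<noteq> v'} \<union>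
     {{Neg (RR v v'), Neg (Q v w), Neg (Q v' w)} | v v' w.
        v \<in> {1..n} \<and> v' \<in> {1..n} \<and> v \<noteq> v' \<and> w \<in> {1..k - 1}}"

end

theory Submission
  imports Defs "HOL-Library.FuncSet" "HOL-Combinatorics.Transposition"
begin

text \<open>Upper bound: a decision tree that ends in falsified clauses turns into an SAR refutation
  whose size is linear in the number of nodes, because branching on \<open>x\<close> costs one complementarity
  axiom and twins turn every branch into a single monomial. The tree asks for each pigeon its place
  and for that place its hole, so it has \<open>O ((n k) ^ k)\<close> nodes.

  Lower bound: choose a random \<open>k\<close>-set \<open>A\<close> of places, send the pigeons bijectively to \<open>A\<close>, and set
  the variables of the other places by random bits. For monomials that do not touch all of \<open>A\<close> there
  is a pseudo-expectation: pick \<open>i\<close> in \<open>A\<close> untouched and average over the bijections of \<open>A - {i}\<close>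
  with the holes; by symmetry the choice of \<open>i\<close> does not matter. Setting it to \<open>0\<close> on the other
  monomials, it is nonnegative on all terms of a refutation unless some monomial survives the
  restriction and touches all of \<open>A\<close>. A fixed monomial mentioning \<open>m\<close> places does so with probability
  at most \<open>(m choose k) x ^ (m - k) / (n choose k)\<close> for a constant \<open>x < 1\<close>, and
  \<open>(m choose k) x ^ (m - k) (1 - x) ^ k \<le> 1\<close> by the binomial theorem; now count monomials.\<close>

section \<open>From decision trees to refutations\<close>

fun compl_lit :: "'a literal \<Rightarrow> 'a literal" where
  "compl_lit (Pos x) = Neg x"
| "compl_lit (Neg x) = Pos x"

definition lit_prod :: "'a literal set \<Rightarrow> 'a rpoly" where
  "lit_prod m = (\<Prod>y\<in>m. rvar y)"

definition valid_term :: "'a cnf \<Rightarrow> 'a sar_term \<Rightarrow> bool" where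
  "valid_term F t \<longleftrightarrow> coefficient t \<ge> 0 \<and>
     finite (factors t) \<and> factors t \<subseteq> literals_of F \<and>
     finite (cofactors t) \<and> cofactors t \<subseteq> literals_of F \<and> base t \<in> sar_axioms F"

definition derives :: "'a cnf \<Rightarrow> 'a rpoly \<Rightarrow> nat \<Rightarrow> bool" where
  "derives F p s \<longleftrightarrow> (\<exists>\<pi>. (\<forall>t\<in>set \<pi>. valid_term F t) \<and>
     (\<Sum>t\<leftarrow>\<pi>. rconst (coefficient t) * term_poly t) = p \<and> sar_size \<pi> \<le> s)"

text \<open>A node of the decision tree is the set \<open>m\<close> of answers on the path to it,
  with a negative answer recorded by the twin, so a node is a single monomial. At the root
  \<open>m\<close> is empty and the goal is \<open>-1\<close>.\<close>

definition refutes :: "'a cnf \<Rightarrow> 'a literal set \<Rightarrow> nat \<Rightarrow> bool" where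
  "refutes F m s \<longleftrightarrow> derives F (- lit_prod m) s"

definition ctx :: "'a cnf \<Rightarrow> 'a literal set \<Rightarrow> bool" where
  "ctx F m \<longleftrightarrow> finite m \<and> m \<subseteq> literals_of F"

lemma vars_ofI: "C \<in> F \<Longrightarrow> l \<in> C \<Longrightarrow> lit_var l \<in> vars_of F"
  by (auto simp: vars_of_def)

lemma derives_zero: "derives F 0 0"
  unfolding derives_def by (rule exI[of _ "[]"]) (simp add: sar_size_def)

lemma derives_add:
  assumes "derives F p s" "derives F q t"
  shows "derives F (p + q) (s + t)"
proof -
  obtain \<pi> \<sigma> where "\<forall>t\<in>set \<pi>. valid_term F t" "(\<Sum>t\<leftarrow>\<pi>. rconst (coefficient t) * term_poly t) = p" "sar_size \<pi> \<le> s"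
   "\<forall>t\<in>set \<sigma>. valid_term F t" "(\<Sum>t\<leftarrow>\<sigma>. rconst (coefficient t) * term_poly t) = q" "sar_size \<sigma> \<le> t"
    using assms unfolding derives_def by (elim exE conjE) (rule that)
  then show ?thesis unfolding derives_def
    by (intro exI[of _ "\<pi> @ \<sigma>"]) (auto simp: sar_size_def)
qed

lemma derives_mono: "derives F p s \<Longrightarrow> s \<le> t \<Longrightarrow> derives F p t"
  unfolding derives_def by (elim exE) (rule exI, auto)

lemma refutes_mono: "refutes F m s \<Longrightarrow> s \<le> t \<Longrightarrow> refutes F m t"
  unfolding refutes_def by (rule derives_mono)

lemma derives_single:
  assumes "ctx F m" "b \<in> sar_axioms F" "num_terms (lit_prod m * b) \<le> s"
  shows "derives F (lit_prod m * b) s"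
  unfolding derives_def
  using assms
  by (intro exI[of _ "[\<lparr>coefficient = 1, factors = m, cofactors = {}, base = b\<rparr>]"])
     (auto simp: valid_term_def ctx_def term_poly_def lit_prod_def sar_size_def rconst_def)

lemma refutes_imp_refutation:
  assumes "refutes F {} s"
  shows "\<exists>\<pi>. sar_refutation F \<pi> \<and> sar_size \<pi> \<le> s"
  using assms unfolding refutes_def derives_def sar_refutation_def valid_term_def
  by (auto simp: lit_prod_def)

lemma lit_prod_insert: "finite m \<Longrightarrow> y \<notin> m \<Longrightarrow> lit_prod (insert y m) = rvar y * lit_prod m"
  by (simp add: lit_prod_def)

lemma lit_prod_eq_single: "finite m \<Longrightarrow>
    lit_prod m = Poly_Mapping.single (\<Sum>y\<in>m. Poly_Mapping.single y 1) 1"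
  by (induction m rule: finite_induct)
     (simp_all add: lit_prod_def rvar_def Poly_Mapping.mult_single)

section \<open>Counting the terms of small polynomials\<close>

lemma num_terms_add: "num_terms (p + q) \<le> num_terms p + num_terms q"
  unfolding num_terms_def
  by (meson card_Un_le card_mono finite_UnI finite_keys keys_add order_trans)

lemma num_terms_minus: "num_terms (- p) = num_terms p"
  by (simp add: num_terms_def)

lemma num_terms_diff: "num_terms (p - q) \<le> num_terms p + num_terms q"
  using num_terms_add[of p "- q"] by (simp add: num_terms_minus)

lemma num_terms_single: "num_terms (Poly_Mapping.single a c) \<le> 1"
  by (simp add: num_terms_def)

lemma num_terms_rvar: "num_terms (rvar y) \<le> 1"
  unfolding rvar_def by (rule num_terms_single)

lemma num_terms_one: "num_terms 1 \<le> 1"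
  using num_terms_single[of 0 1] by simp

lemma num_terms_rvar_sq: "num_terms (rvar y ^ 2) \<le> 1"
  unfolding rvar_def power2_eq_square Poly_Mapping.mult_single mult_1 by (rule num_terms_single)

lemma num_terms_sum: "finite C \<Longrightarrow> num_terms (\<Sum>l\<in>C. rvar l) \<le> card C"
proof (induction C rule: finite_induct)
  case empty
  then show ?case by (simp add: num_terms_def)
next
  case (insert x C)
  then show ?case
    using num_terms_add[of "rvar x" "\<Sum>l\<in>C. rvar l"] num_terms_rvar[of x] by simp
qed

text \<open>Multiplication by a monomial only translates exponents. Hence the cost of an axiom does
  not depend on the depth of the node at which it is used.\<close>

lemma num_terms_lit_prod_mult:
  assumes "finite m"
  shows "num_terms (lit_prod m * p) \<le> num_terms p"
proof -
  let ?a = "\<Sum>y\<in>m. Poly_Mapping.single y (1::nat)"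
  have "Poly_Mapping.keys (lit_prod m * p) \<subseteq> {a + b | a b. a \<in> Poly_Mapping.keys (lit_prod m) \<and> b \<in> Poly_Mapping.keys p}"
    by (rule keys_mult)
  also have "\<dots> \<subseteq> (\<lambda>b. ?a + b) ` Poly_Mapping.keys p"
    using assms by (auto simp: lit_prod_eq_single)
  finally show ?thesis unfolding num_terms_def
    by (meson card_image_le card_mono finite_imageI finite_keys order_trans)
qed

text \<open>With X and X' the variable and its twin, X (1 - X - X') + (X^2 - X) = - X X'. Multiplied
  by the other literals of \<open>m\<close>, the two axioms have 3 and 2 terms.\<close>

lemma refutes_contradictory:
  assumes "ctx F m" "Pos x \<in> m" "Neg x \<in> m"
  shows "refutes F m 5"
proof -
  define m' where "m' = m - {Pos x, Neg x}"
  have m: "m = insert (Neg x) (insert (Pos x) m')" and fin: "finite m'"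
    and c: "ctx F m'" "ctx F (insert (Pos x) m')"
    using assms by (auto simp: m'_def ctx_def)
  have x: "x \<in> vars_of F" "Pos x \<in> literals_of F"
    using assms by (auto simp: ctx_def literals_of_def)
  let ?X = "rvar (Pos x)" and ?X' = "rvar (Neg x)"
  have "num_terms (1 - ?X - ?X') \<le> 3"
    using num_terms_diff[of "1 - ?X" ?X'] num_terms_diff[of 1 ?X] num_terms_one[where 'a='a]
      num_terms_rvar[of "Pos x"] num_terms_rvar[of "Neg x"] by linarith
  then have 1: "derives F (lit_prod (insert (Pos x) m') * (1 - ?X - ?X')) 3"
    using c fin x num_terms_lit_prod_mult[of "insert (Pos x) m'" "1 - ?X - ?X'"]
    by (intro derives_single sar_axioms.compl_lower) auto
  have "num_terms (?X ^ 2 - ?X) \<le> 2"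
    using num_terms_diff[of "?X ^ 2" ?X] num_terms_rvar[of "Pos x"] num_terms_rvar_sq[of "Pos x"]
    by linarith
  then have 2: "derives F (lit_prod m' * (?X ^ 2 - ?X)) 2"
    using c fin x num_terms_lit_prod_mult[of m' "?X ^ 2 - ?X"]
    by (intro derives_single sar_axioms.bool_lower) auto
  have nin: "Pos x \<notin> m'" "Neg x \<notin> insert (Pos x) m'" by (auto simp: m'_def)
  have "lit_prod (insert (Pos x) m') * (1 - ?X - ?X') + lit_prod m' * (?X ^ 2 - ?X) = - lit_prod m"
    unfolding m using nin fin by (simp add: lit_prod_insert algebra_simps power2_eq_square)
  then show ?thesis unfolding refutes_def using derives_add[OF 1 2] by simp
qed

text \<open>The complementarity axiom glues the branches: - m X - m X' + m (-1 + X + X') = - m. If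
  \<open>m\<close> already contains a literal of \<open>x\<close>, one of the branches is
  \<open>m\<close> itself.\<close>

lemma refutes_branch:
  assumes "ctx F m" "x \<in> vars_of F"
    and "refutes F (insert (Pos x) m) s" "refutes F (insert (Neg x) m) t"
  shows "refutes F m (s + t + 3)"
proof (cases "Pos x \<in> m \<or> Neg x \<in> m")
  case True
  then have "refutes F m s \<or> refutes F m t"
    using assms by (metis insert_absorb)
  then show ?thesis by (auto intro: refutes_mono)
next
  case False
  let ?X = "rvar (Pos x)" and ?X' = "rvar (Neg x)"
  have fin: "finite m" using assms by (simp add: ctx_def)
  have "num_terms (- 1 + ?X + ?X') \<le> 3"
    using num_terms_add[of "- 1 + ?X" ?X'] num_terms_add[of "- 1" ?X] num_terms_one[where 'a='a]
      num_terms_rvar[of "Pos x"] num_terms_rvar[of "Neg x"] num_terms_minus[of "1::'a rpoly"] by linarith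
  then have 1: "derives F (lit_prod m * (- 1 + ?X + ?X')) 3"
    using assms fin num_terms_lit_prod_mult[of m "- 1 + ?X + ?X'"]
    by (intro derives_single sar_axioms.compl_upper) auto
  have "- lit_prod (insert (Pos x) m) + - lit_prod (insert (Neg x) m) + lit_prod m * (- 1 + ?X + ?X')
       = - lit_prod m"
    using False fin by (simp add: lit_prod_insert algebra_simps)
  then show ?thesis
    using derives_add[OF derives_add[OF assms(3,4)[unfolded refutes_def]] 1]
    unfolding refutes_def by simp
qed

text \<open>The clause times the monomial of \<open>m\<close> is the sum of all m l minus m, and
  each m l contains \<open>l\<close> together with its twin, so it is removed at cost 5. Three
  literals cost at most (3 + 1) + 3 * 5 = 19.\<close>

lemma refutes_falsified:
  assumes "ctx F m" "C \<in> F" "finite C" "card C \<le> 3" "\<forall>l\<in>C. compl_lit l \<in> m"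
  shows "refutes F m 19"
proof (cases "\<exists>x. Pos x \<in> m \<and> Neg x \<in> m")
  case True
  then show ?thesis using refutes_contradictory assms(1) refutes_mono[of F m 5 19] by fastforce
next
  case False
  have fin: "finite m" using assms by (simp add: ctx_def)
  \<comment> \<open>Polynomials are not multilinear: were \<open>l\<close> in \<open>m\<close>, the
    product m l would contain a square and would not be
    \<open>lit_prod (insert l m)\<close>.\<close>
  have nin: "l \<notin> m" if "l \<in> C" for l
    using False assms(5) that by (cases l) force+
  have sub: "C \<subseteq> literals_of F"
  proof
    fix l assume "l \<in> C"
    then have "lit_var l \<in> vars_of F" using assms(2) by (auto simp: vars_of_def)
    then show "l \<in> literals_of F" by (cases l) (auto simp: literals_of_def)
  qed
  have *: "derives F (- (lit_prod m * (\<Sum>l\<in>B. rvar l))) (5 * card B)" if "B \<subseteq> C" for B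
    using finite_subset[OF that assms(3)] that
  proof (induction B rule: finite_induct)
    case empty
    then show ?case by (simp add: derives_zero)
  next
    case (insert l B)
    have c: "ctx F (insert l m)" using assms(1) sub insert by (auto simp: ctx_def)
    have "refutes F (insert l m) 5"
      using refutes_contradictory[OF c, of "lit_var l"] assms(5) insert.prems
      by (cases l) fastforce+
    then have "derives F (- (rvar l * lit_prod m)) 5"
      unfolding refutes_def using nin[of l] insert.prems fin by (simp add: lit_prod_insert)
    from derives_add[OF this insert.IH] show ?case
      using insert by (simp add: algebra_simps)
  qed
  have "num_terms (clause_poly C) \<le> card C + 1"
    unfolding clause_poly_def
    using num_terms_diff[of "\<Sum>l\<in>C. rvar l" 1] num_terms_one num_terms_sum[OF assms(3)]
    by (smt (verit, best) add_mono_thms_linordered_semiring(1) order_trans)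
  then have "derives F (lit_prod m * clause_poly C) (card C + 1)"
    using assms fin num_terms_lit_prod_mult[of m "clause_poly C"]
    by (intro derives_single sar_axioms.clause) auto
  from derives_add[OF this *[OF subset_refl]] have "derives F (- lit_prod m) (card C + 1 + 5 * card C)"
    by (simp add: clause_poly_def algebra_simps)
  then show ?thesis unfolding refutes_def by (rule derives_mono) (use assms(4) in simp)
qed

lemma refutes_falsified3:
  assumes "ctx F m" "{a, b, c} \<in> F" "compl_lit a \<in> m" "compl_lit b \<in> m" "compl_lit c \<in> m"
  shows "refutes F m 19"
proof (rule refutes_falsified[OF assms(1,2)])
  show "card {a, b, c} \<le> 3"
    by (simp add: card_insert_if)
qed (use assms in auto)

lemma refutes_falsified2:
  assumes "ctx F m" "{a, b} \<in> F" "compl_lit a \<in> m" "compl_lit b \<in> m"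
  shows "refutes F m 19"
  using refutes_falsified3[of F m a b b] assms by simp

text \<open>Quantifying over all larger nodes lets a strategy forget every answer on which it does
  not rely.\<close>

lemma refutes_branch_ctx:
  assumes "ctx F m" "x \<in> vars_of F"
    and "\<And>m'. ctx F m' \<Longrightarrow> insert (Pos x) m \<subseteq> m' \<Longrightarrow> refutes F m' s"
    and "\<And>m'. ctx F m' \<Longrightarrow> insert (Neg x) m \<subseteq> m' \<Longrightarrow> refutes F m' t"
  shows "refutes F m (s + t + 3)"
proof (rule refutes_branch[OF assms(1,2)])
  have "ctx F (insert (Pos x) m)" "ctx F (insert (Neg x) m)"
    using assms(1,2) by (auto simp: ctx_def literals_of_def)
  then show "refutes F (insert (Pos x) m) s" "refutes F (insert (Neg x) m) t"
    using assms(3,4) by blast+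
qed

text \<open>The clauses are those of a wide disjunction \<open>p (a + 1) \<or> \<dots> \<or> p N\<close> broken up by the
  extension variables \<open>y\<close>.\<close>

lemma refutes_chain:
  assumes clauses: "\<And>j. a \<le> j \<Longrightarrow> j + 3 \<le> N \<Longrightarrow> {Neg (y j), Pos (p (j + 1)), Pos (y (j + 1))} \<in> F"
    and last: "{Neg (y (N - 2)), Pos (p (N - 1)), Pos (p N)} \<in> F"
    and step: "\<And>m j. ctx F m \<Longrightarrow> m0 \<subseteq> m \<Longrightarrow> a < j \<Longrightarrow> j \<le> N \<Longrightarrow> Pos (p j) \<in> m \<Longrightarrow> refutes F m s"
  shows "\<lbrakk>a \<le> j; j + 2 \<le> N; ctx F m; m0 \<subseteq> m; Pos (y j) \<in> m\<rbrakk> \<Longrightarrow> refutes F m ((N - j) * (s + 25))"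
proof (induction "N - j" arbitrary: j m)
  case 0
  then show ?case by simp
next
  case (Suc d)
  show ?case
  proof (cases "j + 2 = N")
    case True
    then have C: "{Neg (y j), Pos (p (j + 1)), Pos (p N)} \<in> F" using last by auto
    have v: "p (j + 1) \<in> vars_of F" "p N \<in> vars_of F"
      using vars_ofI[OF C, of "Pos (p (j + 1))"] vars_ofI[OF C, of "Pos (p N)"] by simp_all
    have "refutes F m (s + (s + 19 + 3) + 3)"
    proof (rule refutes_branch_ctx[OF _ v(1)])
      fix m' assume m': "ctx F m'" "insert (Neg (p (j + 1))) m \<subseteq> m'"
      show "refutes F m' (s + 19 + 3)"
      proof (rule refutes_branch_ctx[OF _ v(2)])
        fix m'' assume "ctx F m''" "insert (Neg (p N)) m' \<subseteq> m''"
        then show "refutes F m'' 19"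
          using Suc.prems m' by (intro refutes_falsified3[OF _ C]) auto
      next
        fix m'' assume "ctx F m''" "insert (Pos (p N)) m' \<subseteq> m''"
        then show "refutes F m'' s"
          using Suc.prems m' True by (intro step[of _ N]) auto
      qed (rule m'(1))
    next
      fix m' assume "ctx F m'" "insert (Pos (p (j + 1))) m \<subseteq> m'"
      then show "refutes F m' s"
        using Suc.prems True by (intro step[of _ "j + 1"]) auto
    qed (rule Suc.prems)
    then show ?thesis by (rule refutes_mono) (use True in auto)
  next
    case False
    then have C: "{Neg (y j), Pos (p (j + 1)), Pos (y (j + 1))} \<in> F"
      using Suc.prems clauses by auto
    have v: "p (j + 1) \<in> vars_of F" "y (j + 1) \<in> vars_of F"
      using vars_ofI[OF C, of "Pos (p (j + 1))"] vars_ofI[OF C, of "Pos (y (j + 1))"] by simp_all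
    \<comment> \<open>Each link of the chain costs two branchings of 3 and one falsified clause of
      19; this is the constant 25.\<close>
    have "refutes F m (s + ((N - (j + 1)) * (s + 25) + 19 + 3) + 3)"
    proof (rule refutes_branch_ctx[OF _ v(1)])
      fix m' assume m': "ctx F m'" "insert (Neg (p (j + 1))) m \<subseteq> m'"
      show "refutes F m' ((N - (j + 1)) * (s + 25) + 19 + 3)"
      proof (rule refutes_branch_ctx[OF _ v(2)])
        fix m'' assume "ctx F m''" "insert (Neg (y (j + 1))) m' \<subseteq> m''"
        then show "refutes F m'' 19"
          using Suc.prems m' by (intro refutes_falsified3[OF _ C]) auto
      next
        fix m'' assume "ctx F m''" "insert (Pos (y (j + 1))) m' \<subseteq> m''"
        then show "refutes F m'' ((N - (j + 1)) * (s + 25))"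
          using Suc.hyps(2) Suc.prems m' False by (intro Suc.hyps(1)) auto
      qed (rule m'(1))
    next
      fix m' assume "ctx F m'" "insert (Pos (p (j + 1))) m \<subseteq> m'"
      then show "refutes F m' s"
        using Suc.prems False by (intro step[of _ "j + 1"]) auto
    qed (rule Suc.prems)
    moreover have "N - j = Suc (N - (j + 1))" using Suc.prems by simp
    ultimately show ?thesis by (auto elim!: refutes_mono)
  qed
qed

section \<open>The decision tree for the formula\<close>

lemma erphp_clauses:
  shows "u \<in> {1..k} \<Longrightarrow> {Pos (P u 1), Pos (P u 2), Pos (Y u 2)} \<in> erphp k n"
    and "u \<in> {1..k} \<Longrightarrow> v \<in> {2..n - 3} \<Longrightarrow>
      {Neg (Y u v), Pos (P u (v + 1)), Pos (Y u (v + 1))} \<in> erphp k n"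
    and "u \<in> {1..k} \<Longrightarrow> {Neg (Y u (n - 2)), Pos (P u (n - 1)), Pos (P u n)} \<in> erphp k n"
    and "v \<in> {1..n} \<Longrightarrow> {Neg (R v), Pos (Q v 1), Pos (Z v 1)} \<in> erphp k n"
    and "v \<in> {1..n} \<Longrightarrow> w \<in> {1..k - 4} \<Longrightarrow>
      {Neg (Z v w), Pos (Q v (w + 1)), Pos (Z v (w + 1))} \<in> erphp k n"
    and "v \<in> {1..n} \<Longrightarrow> {Neg (Z v (k - 3)), Pos (Q v (k - 2)), Pos (Q v (k - 1))} \<in> erphp k n"
    and "u \<in> {1..k} \<Longrightarrow> u' \<in> {1..k} \<Longrightarrow> u \<noteq> u' \<Longrightarrow> v \<in> {1..n} \<Longrightarrow>
      {Neg (P u v), Neg (P u' v)} \<in> erphp k n"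
    and "u \<in> {1..k} \<Longrightarrow> v \<in> {1..n} \<Longrightarrow> {Neg (P u v), Pos (R v)} \<in> erphp k n"
    and "v \<in> {1..n} \<Longrightarrow> v' \<in> {1..n} \<Longrightarrow> v \<noteq> v' \<Longrightarrow>
      {Neg (R v), Neg (R v'), Pos (RR v v')} \<in> erphp k n"
    and "v \<in> {1..n} \<Longrightarrow> v' \<in> {1..n} \<Longrightarrow> v \<noteq> v' \<Longrightarrow> w \<in> {1..k - 1} \<Longrightarrow>
      {Neg (RR v v'), Neg (Q v w), Neg (Q v' w)} \<in> erphp k n"
  unfolding erphp_def
  subgoal by (rule UnI1, rule UnI1, rule UnI1, rule UnI1, rule UnI1, rule UnI1, rule UnI1, rule UnI1, rule UnI1, blast)
  subgoal by (rule UnI1, rule UnI1, rule UnI1, rule UnI1, rule UnI1, rule UnI1, rule UnI1, rule UnI1, rule UnI2, blast)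
  subgoal by (rule UnI1, rule UnI1, rule UnI1, rule UnI1, rule UnI1, rule UnI1, rule UnI1, rule UnI2, blast)
  subgoal by (rule UnI1, rule UnI1, rule UnI1, rule UnI1, rule UnI1, rule UnI1, rule UnI2, blast)
  subgoal by (rule UnI1, rule UnI1, rule UnI1, rule UnI1, rule UnI1, rule UnI2, blast)
  subgoal by (rule UnI1, rule UnI1, rule UnI1, rule UnI1, rule UnI2, blast)
  subgoal by (rule UnI1, rule UnI1, rule UnI1, rule UnI2, blast)
  subgoal by (rule UnI1, rule UnI1, rule UnI2, blast)
  subgoal by (rule UnI1, rule UnI2, blast)
  subgoal by (rule UnI2, blast)
  done

text \<open>\<open>N\<close> stands for \<open>n * k\<close>, the branching caused by one pigeon,
  and \<open>j\<close> for the number of pigeons still to be queried. A leaf costs 41 by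
  \<open>refutes_erphp_collision\<close>; the 50 covers the overheads of 25 of the place query and
  the hole query.\<close>

fun tree_cost :: "nat \<Rightarrow> nat \<Rightarrow> nat" where
  "tree_cost N 0 = 41"
| "tree_cost N (Suc j) = N * (tree_cost N j + 50)"

text \<open>The added 100 makes the induction close: for \<open>N\<close> at least 2,
  \<open>N * (c + 50) + 100\<close> is at most \<open>N * (c + 100)\<close>. The constant is 41 +
  100.\<close>

lemma tree_cost_le: "2 \<le> N \<Longrightarrow> tree_cost N j + 100 \<le> 141 * N ^ j"
proof (induction j)
  case 0
  then show ?case by simp
next
  case (Suc j)
  have "tree_cost N (Suc j) + 100 \<le> N * (tree_cost N j + 100)"
    using Suc.prems by (simp add: algebra_simps)
  also have "\<dots> \<le> N * (141 * N ^ j)" using Suc by (intro mult_le_mono2) simp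
  finally show ?case by (simp add: algebra_simps)
qed

text \<open>Two pigeons have ended in the same hole. If they share a place, a clause is already
  falsified; otherwise either answer to the query \<open>RR v v'\<close> falsifies one.\<close>

lemma refutes_erphp_collision:
  assumes "ctx (erphp k n) m" "u \<in> {1..k}" "u' \<in> {1..k}" "u \<noteq> u'" "v \<in> {1..n}" "v' \<in> {1..n}"
    and "Pos (P u v) \<in> m" "Pos (P u' v') \<in> m" "Pos (R v) \<in> m" "Pos (R v') \<in> m"
    and "w \<in> {1..k - 1}" "Pos (Q v w) \<in> m" "Pos (Q v' w) \<in> m"
  shows "refutes (erphp k n) m 41"
proof (cases "v = v'")
  case True
  then have "refutes (erphp k n) m 19"
    using assms by (intro refutes_falsified2[OF _ erphp_clauses(7)[of u k u' v n]]) auto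
  then show ?thesis by (rule refutes_mono) simp
next
  case False
  have C: "{Neg (R v), Neg (R v'), Pos (RR v v')} \<in> erphp k n"
    "{Neg (RR v v'), Neg (Q v w), Neg (Q v' w)} \<in> erphp k n"
    using erphp_clauses(9,10) False assms by auto
  have v: "RR v v' \<in> vars_of (erphp k n)" using vars_ofI[OF C(1), of "Pos (RR v v')"] by simp
  have "refutes (erphp k n) m (19 + 19 + 3)"
  proof (rule refutes_branch_ctx[OF assms(1) v])
    fix m' assume "ctx (erphp k n) m'" "insert (Pos (RR v v')) m \<subseteq> m'"
    then show "refutes (erphp k n) m' 19"
      using assms by (intro refutes_falsified3[OF _ C(2)]) auto
  next
    fix m' assume "ctx (erphp k n) m'" "insert (Neg (RR v v')) m \<subseteq> m'"
    then show "refutes (erphp k n) m' 19"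
      using assms by (intro refutes_falsified3[OF _ C(1)]) auto
  qed
  then show ?thesis by simp
qed

lemma refutes_erphp_hole:
  assumes "4 \<le> k" "u \<in> {1..k}" "v \<in> {1..n}"
    and m: "ctx (erphp k n) m" "Pos (P u v) \<in> m"
    and step: "\<And>m' w. ctx (erphp k n) m' \<Longrightarrow> m \<subseteq> m' \<Longrightarrow> Pos (R v) \<in> m' \<Longrightarrow> w \<in> {1..k - 1} \<Longrightarrow>
       Pos (Q v w) \<in> m' \<Longrightarrow> refutes (erphp k n) m' s"
  shows "refutes (erphp k n) m (k * (s + 25))"
proof -
  let ?F = "erphp k n"
  have C: "{Neg (P u v), Pos (R v)} \<in> ?F" "{Neg (R v), Pos (Q v 1), Pos (Z v 1)} \<in> ?F"
    using erphp_clauses(4,8) assms by auto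
  have v: "R v \<in> vars_of ?F" "Q v 1 \<in> vars_of ?F" "Z v 1 \<in> vars_of ?F"
    using vars_ofI[OF C(1), of "Pos (R v)"] vars_ofI[OF C(2), of "Pos (Q v 1)"]
      vars_ofI[OF C(2), of "Pos (Z v 1)"] by simp_all
  have "refutes ?F m ((s + ((k - 1 - 1) * (s + 25) + 19 + 3) + 3) + 19 + 3)"
  proof (rule refutes_branch_ctx[OF m(1) v(1)])
    fix m1 assume "ctx ?F m1" "insert (Neg (R v)) m \<subseteq> m1"
    then show "refutes ?F m1 19"
      using assms by (intro refutes_falsified2[OF _ C(1)]) auto
  next
    fix m1 assume m1: "ctx ?F m1" "insert (Pos (R v)) m \<subseteq> m1"
    show "refutes ?F m1 (s + ((k - 1 - 1) * (s + 25) + 19 + 3) + 3)"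
    proof (rule refutes_branch_ctx[OF m1(1) v(2)])
      fix m2 assume "ctx ?F m2" "insert (Pos (Q v 1)) m1 \<subseteq> m2"
      then show "refutes ?F m2 s"
        using assms(1) m1 by (intro step[of _ 1]) auto
    next
      fix m2 assume m2: "ctx ?F m2" "insert (Neg (Q v 1)) m1 \<subseteq> m2"
      show "refutes ?F m2 ((k - 1 - 1) * (s + 25) + 19 + 3)"
      proof (rule refutes_branch_ctx[OF m2(1) v(3)])
        fix m3 assume "ctx ?F m3" "insert (Neg (Z v 1)) m2 \<subseteq> m3"
        then show "refutes ?F m3 19"
          using m1 m2 by (intro refutes_falsified3[OF _ C(2)]) auto
      next
        fix m3 assume m3: "ctx ?F m3" "insert (Pos (Z v 1)) m2 \<subseteq> m3"
        show "refutes ?F m3 ((k - 1 - 1) * (s + 25))"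
        proof (rule refutes_chain[where a = 1 and y = "Z v" and p = "Q v" and ?m0.0 = m1])
          fix j assume "1 \<le> j" "j + 3 \<le> k - 1"
          then show "{Neg (Z v j), Pos (Q v (j + 1)), Pos (Z v (j + 1))} \<in> ?F"
            using assms by (intro erphp_clauses) auto
        next
          show "{Neg (Z v (k - 1 - 2)), Pos (Q v (k - 1 - 1)), Pos (Q v (k - 1))} \<in> ?F"
            using erphp_clauses(6)[OF assms(3), of k] assms(1) by (simp add: numeral_eq_Suc)
        next
          fix m' j assume "ctx ?F m'" "m1 \<subseteq> m'" "1 < j" "j \<le> k - 1" "Pos (Q v j) \<in> m'"
          then show "refutes ?F m' s"
            using m1 by (intro step[of _ j]) auto
        qed (use assms m2 m3 in auto)
      qed
    qed
  qed
  then show ?thesis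
  proof (rule refutes_mono)
    \<comment> \<open>The queries outside the chain of length \<open>k - 2\<close> cost
      \<open>s + 47\<close> in total, which two further shares \<open>s + 25\<close> cover.\<close>
    define l where "l = k - 2"
    then have "k = Suc (Suc l)" using assms(1) by simp
    then show "(s + ((k - 1 - 1) * (s + 25) + 19 + 3) + 3) + 19 + 3 \<le> k * (s + 25)"
      by simp
  qed
qed

lemma refutes_erphp_place:
  assumes "4 \<le> n" "u \<in> {1..k}"
    and m: "ctx (erphp k n) m"
    and step: "\<And>m' v. ctx (erphp k n) m' \<Longrightarrow> m \<subseteq> m' \<Longrightarrow> v \<in> {1..n} \<Longrightarrow> Pos (P u v) \<in> m' \<Longrightarrow>
       refutes (erphp k n) m' s"
  shows "refutes (erphp k n) m (n * (s + 25))"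
proof -
  let ?F = "erphp k n"
  have C: "{Pos (P u 1), Pos (P u 2), Pos (Y u 2)} \<in> ?F"
    using erphp_clauses(1) assms by auto
  have v: "P u 1 \<in> vars_of ?F" "P u 2 \<in> vars_of ?F" "Y u 2 \<in> vars_of ?F"
    using vars_ofI[OF C, of "Pos (P u 1)"] vars_ofI[OF C, of "Pos (P u 2)"]
      vars_ofI[OF C, of "Pos (Y u 2)"] by simp_all
  have "refutes ?F m (s + (s + ((n - 2) * (s + 25) + 19 + 3) + 3) + 3)"
  proof (rule refutes_branch_ctx[OF m(1) v(1)])
    fix m1 assume "ctx ?F m1" "insert (Pos (P u 1)) m \<subseteq> m1"
    then show "refutes ?F m1 s"
      using assms(1) by (intro step[of _ 1]) auto
  next
    fix m1 assume m1: "ctx ?F m1" "insert (Neg (P u 1)) m \<subseteq> m1"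
    show "refutes ?F m1 (s + ((n - 2) * (s + 25) + 19 + 3) + 3)"
    proof (rule refutes_branch_ctx[OF m1(1) v(2)])
      fix m2 assume "ctx ?F m2" "insert (Pos (P u 2)) m1 \<subseteq> m2"
      then show "refutes ?F m2 s"
        using assms(1) m1 by (intro step[of _ 2]) auto
    next
      fix m2 assume m2: "ctx ?F m2" "insert (Neg (P u 2)) m1 \<subseteq> m2"
      show "refutes ?F m2 ((n - 2) * (s + 25) + 19 + 3)"
      proof (rule refutes_branch_ctx[OF m2(1) v(3)])
        fix m3 assume "ctx ?F m3" "insert (Neg (Y u 2)) m2 \<subseteq> m3"
        then show "refutes ?F m3 19"
          using m1 m2 by (intro refutes_falsified3[OF _ C]) auto
      next
        fix m3 assume m3: "ctx ?F m3" "insert (Pos (Y u 2)) m2 \<subseteq> m3"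
        show "refutes ?F m3 ((n - 2) * (s + 25))"
        proof (rule refutes_chain[where a = 2 and y = "Y u" and p = "P u" and ?m0.0 = m])
          fix j assume "2 \<le> j" "j + 3 \<le> n"
          then show "{Neg (Y u j), Pos (P u (j + 1)), Pos (Y u (j + 1))} \<in> ?F"
            using assms by (intro erphp_clauses) auto
        next
          show "{Neg (Y u (n - 2)), Pos (P u (n - 1)), Pos (P u n)} \<in> ?F"
            using erphp_clauses(3)[OF assms(2)] .
        next
          fix m' j assume "ctx ?F m'" "m \<subseteq> m'" "2 < j" "j \<le> n" "Pos (P u j) \<in> m'"
          then show "refutes ?F m' s"
            by (intro step[of _ j]) auto
        qed (use assms m1 m2 m3 in auto)
      qed
    qed
  qed
  then show ?thesis
  proof (rule refutes_mono)
    define l where "l = n - 2"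
    then have "n = Suc (Suc l)" using assms(1) by simp
    then show "s + (s + ((n - 2) * (s + 25) + 19 + 3) + 3) + 3 \<le> n * (s + 25)"
      by simp
  qed
qed

text \<open>Here \<open>j\<close> counts the pigeons not yet queried, while \<open>f\<close> and
  \<open>h\<close> record places and holes of the others. The pigeon queried next is
  \<open>k - j\<close> for the decremented \<open>j\<close>. At \<open>j = 0\<close> the map
  \<open>h\<close> sends \<open>k\<close> pigeons to \<open>k - 1\<close> holes, so two of them
  collide.\<close>

lemma refutes_erphp:
  assumes "4 \<le> k" "4 \<le> n"
  shows "\<lbrakk>j \<le> k; ctx (erphp k n) m; \<forall>i\<in>{1..k - j}. f i \<in> {1..n} \<and> h i \<in> {1..k - 1} \<and>
      Pos (P i (f i)) \<in> m \<and> Pos (R (f i)) \<in> m \<and> Pos (Q (f i) (h i)) \<in> m\<rbrakk>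
    \<Longrightarrow> refutes (erphp k n) m (tree_cost (n * k) j)"
proof (induction j arbitrary: m f h)
  case 0
  have "\<not> inj_on h {1..k}"
  proof
    assume "inj_on h {1..k}"
    moreover have "h ` {1..k} \<subseteq> {1..k - 1}" using 0 by auto
    ultimately have "card {1..k} \<le> card {1..k - 1}" by (rule card_inj_on_le) simp
    then show False using assms by simp
  qed
  then obtain u u' where u: "u \<in> {1..k}" "u' \<in> {1..k}" "u \<noteq> u'" "h u = h u'"
    by (auto simp: inj_on_def)
  have "refutes (erphp k n) m 41"
    using bspec[OF 0(3), of u] bspec[OF 0(3), of u'] u 0(2)
    by (intro refutes_erphp_collision[of k n m u u' "f u" "f u'" "h u"]) simp_all
  then show ?case by simp
next
  case (Suc j)
  let ?u = "k - j" and ?s = "tree_cost (n * k) j"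
  have u: "?u \<in> {1..k}" using Suc.prems by auto
  have "refutes (erphp k n) m (n * (k * (?s + 25) + 25))"
  proof (rule refutes_erphp_place[OF assms(2) u Suc.prems(2)])
    fix m1 v assume m1: "ctx (erphp k n) m1" "m \<subseteq> m1" "v \<in> {1..n}" "Pos (P ?u v) \<in> m1"
    show "refutes (erphp k n) m1 (k * (?s + 25))"
    proof (rule refutes_erphp_hole[OF assms(1) u m1(3,1,4)])
      fix m2 w assume m2: "ctx (erphp k n) m2" "m1 \<subseteq> m2" "Pos (R v) \<in> m2" "w \<in> {1..k - 1}"
        "Pos (Q v w) \<in> m2"
      show "refutes (erphp k n) m2 ?s"
      proof (rule Suc.IH[where f = "f(?u := v)" and h = "h(?u := w)"])
        show "\<forall>i\<in>{1..?u}. (f(?u := v)) i \<in> {1..n} \<and> (h(?u := w)) i \<in> {1..k - 1} \<and>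
          Pos (P i ((f(?u := v)) i)) \<in> m2 \<and> Pos (R ((f(?u := v)) i)) \<in> m2 \<and>
          Pos (Q ((f(?u := v)) i) ((h(?u := w)) i)) \<in> m2"
        proof
          fix i assume "i \<in> {1..?u}"
          then consider "i = ?u" | "i \<in> {1..k - Suc j}" "i \<noteq> ?u" by fastforce
          then show "(f(?u := v)) i \<in> {1..n} \<and> (h(?u := w)) i \<in> {1..k - 1} \<and>
            Pos (P i ((f(?u := v)) i)) \<in> m2 \<and> Pos (R ((f(?u := v)) i)) \<in> m2 \<and>
            Pos (Q ((f(?u := v)) i) ((h(?u := w)) i)) \<in> m2"
          proof cases
            case 1
            then show ?thesis using m1 m2 by (simp add: subset_iff)
          next
            case 2
            then show ?thesis using m1(2) m2(2) bspec[OF Suc.prems(3) 2(1)] by (simp add: subset_iff)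
          qed
        qed
      qed (use Suc.prems m2 in auto)
    qed
  qed
  then show ?case
  proof (rule refutes_mono)
    have "k * (?s + 25) + 25 \<le> k * (?s + 50)" using assms(1) by (simp add: algebra_simps)
    then show "n * (k * (?s + 25) + 25) \<le> tree_cost (n * k) (Suc j)"
      by (simp add: mult.assoc del: distrib_left distrib_right)
  qed
qed

lemma erphp_upper_bound:
  assumes "4 \<le> k" "4 \<le> n"
  shows "\<exists>\<pi>. sar_refutation (erphp k n) \<pi> \<and> sar_size \<pi> \<le> 141 * (n * k) ^ k"
proof -
  have "refutes (erphp k n) {} (tree_cost (n * k) k)"
    \<comment> \<open>At the root no pigeon has been queried, so the range of the condition on
      \<open>f\<close> and \<open>h\<close> is empty and any values do.\<close>
    by (rule refutes_erphp[where f = undefined and h = undefined]) (use assms in \<open>auto simp: ctx_def\<close>)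
  moreover have "2 \<le> n * k"
    using mult_le_mono[OF assms(2,1)] by linarith
  ultimately have "refutes (erphp k n) {} (141 * (n * k) ^ k)"
    using tree_cost_le[of "n * k" k] by (auto elim: refutes_mono)
  then show ?thesis by (rule refutes_imp_refutation)
qed

section \<open>Linear functionals and cancellation-free products\<close>

definition lin :: "('b \<Rightarrow> real) \<Rightarrow> ('b \<Rightarrow>\<^sub>0 real) \<Rightarrow> real" where
  "lin \<phi> p = (\<Sum>m\<in>Poly_Mapping.keys p. Poly_Mapping.lookup p m * \<phi> m)"

lemma lin_superset:
  "finite S \<Longrightarrow> Poly_Mapping.keys p \<subseteq> S \<Longrightarrow> lin \<phi> p = (\<Sum>m\<in>S. Poly_Mapping.lookup p m * \<phi> m)"
  unfolding lin_def by (rule sum.mono_neutral_left) (auto simp: in_keys_iff)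

lemma lin_add: "lin \<phi> (p + q) = lin \<phi> p + lin \<phi> q"
proof -
  let ?S = "Poly_Mapping.keys p \<union> Poly_Mapping.keys q"
  have "lin \<phi> r = (\<Sum>m\<in>?S. Poly_Mapping.lookup r m * \<phi> m)" if "r \<in> {p, q, p + q}" for r
    using that keys_add[of p q] by (intro lin_superset) auto
  then show ?thesis by (simp add: lookup_add algebra_simps sum.distrib)
qed

lemma lin_minus: "lin \<phi> (- p) = - lin \<phi> p"
  by (simp add: lin_def sum_negf)

lemma lin_diff: "lin \<phi> (p - q) = lin \<phi> p - lin \<phi> q"
  using lin_add[of \<phi> p "- q"] by (simp add: lin_minus)

lemma lin_zero [simp]: "lin \<phi> 0 = 0"
  by (simp add: lin_def)

lemma lin_sum: "lin \<phi> (sum f S) = (\<Sum>x\<in>S. lin \<phi> (f x))"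
  by (induction S rule: infinite_finite_induct) (simp_all add: lin_add)

lemma lin_sum_list: "lin \<phi> (sum_list ps) = (\<Sum>p\<leftarrow>ps. lin \<phi> p)"
  by (induction ps) (simp_all add: lin_add)

lemma lin_single: "lin \<phi> (Poly_Mapping.single a c) = c * \<phi> a"
  by (simp add: lin_def)

lemma lin_one: "lin \<phi> 1 = \<phi> 0"
  using lin_single[of \<phi> 0 1] by simp

lemma lin_cong: "(\<And>m. m \<in> Poly_Mapping.keys p \<Longrightarrow> \<phi> m = \<psi> m) \<Longrightarrow> lin \<phi> p = lin \<psi> p"
  by (simp add: lin_def)

lemma lin_scale: "lin (\<lambda>m. c * \<phi> m) p = c * lin \<phi> p"
  by (simp add: lin_def sum_distrib_left mult.left_commute)

lemma lin_sum_functional: "lin (\<lambda>m. \<Sum>x\<in>S. \<phi> x m) p = (\<Sum>x\<in>S. lin (\<phi> x) p)"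
  unfolding lin_def by (subst sum.swap) (simp add: sum_distrib_left)

lemma sum_single_lookup:
  fixes p :: "'b \<Rightarrow>\<^sub>0 real"
  shows "(\<Sum>a\<in>Poly_Mapping.keys p. Poly_Mapping.single a (Poly_Mapping.lookup p a)) = p"
  by (rule poly_mapping_eqI) (simp add: lookup_sum lookup_single when_def in_keys_iff)

text \<open>A monomial factor moves from the polynomial into a shift of the functional, so a factor
  of a term can be treated without expanding the rest.\<close>

lemma lin_single_mult:
  "lin \<phi> (Poly_Mapping.single a c * p) = c * lin (\<lambda>m. \<phi> (a + m)) p"
proof -
  have "lin \<phi> (Poly_Mapping.single a c * p) =
    lin \<phi> (\<Sum>m\<in>Poly_Mapping.keys p. Poly_Mapping.single a c * Poly_Mapping.single m (Poly_Mapping.lookup p m))"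
    by (simp only: sum_distrib_left[symmetric] sum_single_lookup)
  then show ?thesis
    by (simp add: lin_sum Poly_Mapping.mult_single lin_single)
       (simp add: lin_def sum_distrib_left mult.assoc)
qed

lemma lin_rvar_mult: "lin \<phi> (rvar y * p) = lin (\<lambda>m. \<phi> (Poly_Mapping.single y 1 + m)) p"
  by (simp add: rvar_def lin_single_mult)

lemma lin_rconst_mult: "lin \<phi> (rconst c * p) = c * lin \<phi> p"
  by (simp add: rconst_def lin_single_mult)

definition lits :: "'a rpoly \<Rightarrow> 'a literal set" where
  "lits p = (\<Union>m\<in>Poly_Mapping.keys p. Poly_Mapping.keys m)"

lemma keys_add_nat:
  fixes a b :: "'b \<Rightarrow>\<^sub>0 nat"
  shows "Poly_Mapping.keys (a + b) = Poly_Mapping.keys a \<union> Poly_Mapping.keys b"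
  by (auto simp: in_keys_iff lookup_add)

lemma lits_mult: "lits (p * q) \<subseteq> lits p \<union> lits q"
  using keys_mult[of p q] by (fastforce simp: lits_def keys_add_nat)

lemma lits_rvar: "lits (rvar y) = {y}"
  by (simp add: lits_def rvar_def)

lemma lits_one: "lits 1 = {}"
  by (simp add: lits_def)

lemma lits_diff: "lits (p - q) \<subseteq> lits p \<union> lits q"
  using keys_diff[of p q] by (auto simp: lits_def)

lemma lits_add: "lits (p + q) \<subseteq> lits p \<union> lits q"
  using keys_add[of p q] by (auto simp: lits_def)

lemma lits_sum: "lits (sum f S) \<subseteq> (\<Union>x\<in>S. lits (f x))"
proof (induction S rule: infinite_finite_induct)
  case (insert x S)
  then show ?case using lits_add[of "f x" "sum f S"] by auto
qed (simp_all add: lits_def)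

lemma lits_prod: "lits (prod f S) \<subseteq> (\<Union>x\<in>S. lits (f x))"
proof (induction S rule: infinite_finite_induct)
  case (insert x S)
  then show ?case using lits_mult[of "f x" "prod f S"] by auto
qed (simp_all add: lits_one)

lemma lits_term_poly: "lits (term_poly t) \<subseteq> factors t \<union> cofactors t \<union> lits (base t)"
proof -
  have "lits (\<Prod>y\<in>factors t. rvar y) \<subseteq> factors t"
    using lits_prod[of rvar "factors t"] by (simp add: lits_rvar)
  moreover have "lits (\<Prod>y\<in>cofactors t. 1 - rvar y) \<subseteq> cofactors t"
    using lits_prod[of "\<lambda>y. 1 - rvar y" "cofactors t"] lits_diff[of 1]
    by (fastforce simp: lits_rvar lits_one)
  ultimately show ?thesis
    unfolding term_poly_def
    using lits_mult[of "(\<Prod>y\<in>factors t. rvar y) * (\<Prod>y\<in>cofactors t. 1 - rvar y)" "base t"]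
      lits_mult[of "\<Prod>y\<in>factors t. rvar y" "\<Prod>y\<in>cofactors t. 1 - rvar y"] by blast
qed

section \<open>Sign patterns that exclude cancellation\<close>

lemma single_Suc_0_eq_iff [simp]:
  "Poly_Mapping.single y (Suc 0) = Poly_Mapping.single z (Suc 0) \<longleftrightarrow> y = z"
  by (metis keys_single nat.distinct(1) singleton_inject)

lemma single_Suc_0_neq_0 [simp]: "Poly_Mapping.single y (Suc 0) \<noteq> 0" "0 \<noteq> Poly_Mapping.single y (Suc 0)"
  by (metis keys_eq_empty keys_single nat.distinct(1) singletonI empty_iff)+

definition deg :: "('b \<Rightarrow>\<^sub>0 nat) \<Rightarrow> nat" where
  "deg m = (\<Sum>l\<in>Poly_Mapping.keys m. Poly_Mapping.lookup m l)"

lemma deg_add: "deg (a + b) = deg a + deg b"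
proof -
  let ?S = "Poly_Mapping.keys a \<union> Poly_Mapping.keys b"
  have "deg r = (\<Sum>m\<in>?S. Poly_Mapping.lookup r m)" if "r \<in> {a, b, a + b}" for r
    unfolding deg_def using that by (intro sum.mono_neutral_left) (auto simp: keys_add_nat in_keys_iff)
  then show ?thesis by (simp add: lookup_add sum.distrib)
qed

lemma deg_zero [simp]: "deg 0 = 0"
  by (simp add: deg_def)

lemma deg_single [simp]: "deg (Poly_Mapping.single y a) = a"
  by (simp add: deg_def)

text \<open>Up to a global sign, substituting \<open>- y\<close> for every variable \<open>y\<close> makes all coefficients
  nonnegative; hence no monomial cancels in products of such polynomials.\<close>

definition alternating :: "real \<Rightarrow> (('b \<Rightarrow>\<^sub>0 nat) \<Rightarrow>\<^sub>0 real) \<Rightarrow> bool" where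
  "alternating s p \<longleftrightarrow> \<bar>s\<bar> = 1 \<and> (\<forall>m. 0 \<le> s * (- 1) ^ deg m * Poly_Mapping.lookup p m)"

lemma lookup_mult_sum:
  fixes p q :: "('b \<Rightarrow>\<^sub>0 nat) \<Rightarrow>\<^sub>0 real"
  shows "Poly_Mapping.lookup (p * q) c = (\<Sum>a\<in>Poly_Mapping.keys p. \<Sum>b\<in>Poly_Mapping.keys q.
     Poly_Mapping.lookup p a * Poly_Mapping.lookup q b when a + b = c)"
proof -
  have "p * q = (\<Sum>a\<in>Poly_Mapping.keys p. Poly_Mapping.single a (Poly_Mapping.lookup p a)) *
      (\<Sum>b\<in>Poly_Mapping.keys q. Poly_Mapping.single b (Poly_Mapping.lookup q b))"
    by (simp only: sum_single_lookup)
  also have "\<dots> = (\<Sum>a\<in>Poly_Mapping.keys p. \<Sum>b\<in>Poly_Mapping.keys q.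
      Poly_Mapping.single (a + b) (Poly_Mapping.lookup p a * Poly_Mapping.lookup q b))"
    by (simp add: sum_product Poly_Mapping.mult_single)
  finally show ?thesis by (simp add: lookup_sum lookup_single)
qed

text \<open>The degree is additive, so the sign (-1)^deg is multiplicative, and the signed
  coefficients of a product are the convolution of those of its factors.\<close>

lemma alternating_mult_coeff:
  fixes p q :: "('b \<Rightarrow>\<^sub>0 nat) \<Rightarrow>\<^sub>0 real" and s s' :: real
  shows "s * s' * (- 1) ^ deg c * Poly_Mapping.lookup (p * q) c =
    (\<Sum>a\<in>Poly_Mapping.keys p. \<Sum>b\<in>Poly_Mapping.keys q.
      (s * (- 1) ^ deg a * Poly_Mapping.lookup p a) *
      (s' * (- 1) ^ deg b * Poly_Mapping.lookup q b) when a + b = c)"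
  by (simp only: lookup_mult_sum sum_distrib_left, intro sum.cong refl)
     (auto simp: when_def deg_add power_add)

lemma alternating_mult:
  assumes "alternating s p" "alternating s' q"
  shows "alternating (s * s') (p * q)"
  using assms unfolding alternating_def alternating_mult_coeff
  by (auto simp: abs_mult when_def intro!: sum_nonneg mult_nonneg_nonneg)

text \<open>The signed coefficient at \<open>a + b\<close> is a sum of nonnegative contributions,
  and the pair \<open>a\<close>, \<open>b\<close> makes a positive one.\<close>

lemma alternating_keys_mult:
  assumes "alternating s p" "alternating s' q" "a \<in> Poly_Mapping.keys p" "b \<in> Poly_Mapping.keys q"
  shows "a + b \<in> Poly_Mapping.keys (p * q)"
proof -
  let ?f = "\<lambda>x y. (s * (- 1) ^ deg x * Poly_Mapping.lookup p x) *
      (s' * (- 1) ^ deg y * Poly_Mapping.lookup q y) when x + y = a + b"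
  have nn: "0 \<le> ?f x y" for x y
    using assms(1,2) unfolding alternating_def when_def by (auto intro: mult_nonneg_nonneg)
  have "?f a b \<noteq> 0"
    using assms by (auto simp: alternating_def in_keys_iff)
  with nn[of a b] have "0 < ?f a b" by linarith
  also have "?f a b \<le> (\<Sum>y\<in>Poly_Mapping.keys q. ?f a y)"
    using assms(4) nn by (intro member_le_sum) auto
  also have "\<dots> \<le> (\<Sum>x\<in>Poly_Mapping.keys p. \<Sum>y\<in>Poly_Mapping.keys q. ?f x y)"
    using assms(3) nn by (intro member_le_sum[of a _ "\<lambda>x. \<Sum>y\<in>Poly_Mapping.keys q. ?f x y"] sum_nonneg) auto
  also have "\<dots> = s * s' * (- 1) ^ deg (a + b) * Poly_Mapping.lookup (p * q) (a + b)"
    by (rule alternating_mult_coeff[symmetric])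
  finally show ?thesis by (auto simp: in_keys_iff)
qed

lemma lookup_rvar: "Poly_Mapping.lookup (rvar y) m = (if m = Poly_Mapping.single y 1 then 1 else 0)"
  by (auto simp: rvar_def lookup_single when_def)

lemma lookup_rvar_sq:
  "Poly_Mapping.lookup (rvar y ^ 2) m = (if m = Poly_Mapping.single y 2 then 1 else 0)"
  by (auto simp: rvar_def power2_eq_square Poly_Mapping.mult_single lookup_single when_def
      single_add[symmetric] numeral_2_eq_2)

lemma alternating_one_minus_rvar: "alternating 1 (1 - rvar y)"
  by (auto simp: alternating_def lookup_minus lookup_rvar lookup_one when_def)

lemma alternating_prod:
  assumes "\<And>y. y \<in> S \<Longrightarrow> alternating 1 (f y)"
  shows "alternating 1 (prod f S)"
  using assms
proof (induction S rule: infinite_finite_induct)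
  case (insert x S)
  then show ?case using alternating_mult[of 1 "f x" 1 "prod f S"] by simp
qed (auto simp: alternating_def lookup_one when_def)

definition lit_monom :: "'a literal set \<Rightarrow> 'a literal \<Rightarrow>\<^sub>0 nat" where
  "lit_monom S = (\<Sum>y\<in>S. Poly_Mapping.single y 1)"

lemma keys_lit_monom: "finite S \<Longrightarrow> Poly_Mapping.keys (lit_monom S) = S"
  by (induction S rule: finite_induct) (simp_all add: lit_monom_def keys_add_nat)

lemma lit_prod_eq_lit_monom: "finite S \<Longrightarrow> lit_prod S = Poly_Mapping.single (lit_monom S) 1"
  by (simp add: lit_prod_eq_single lit_monom_def)

lemma alternating_lit_prod: "finite S \<Longrightarrow> alternating ((- 1) ^ deg (lit_monom S)) (lit_prod S)"
  by (auto simp: alternating_def lit_prod_eq_lit_monom lookup_single when_def power_abs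
      power_mult_distrib[symmetric])

text \<open>Take the literal from the factors indexed by \<open>S\<close> and the 1 from all others;
  nothing cancels this choice.\<close>

lemma lit_monom_in_keys_cofactor_prod:
  assumes "finite J" "S \<subseteq> J"
  shows "lit_monom S \<in> Poly_Mapping.keys (\<Prod>y\<in>J. 1 - rvar y)"
  using assms
proof (induction J arbitrary: S rule: finite_induct)
  case empty
  then show ?case by (simp add: lit_monom_def)
next
  case (insert y J)
  have fin: "finite S" using insert by (meson finite_insert finite_subset)
  have IH: "lit_monom (S - {y}) \<in> Poly_Mapping.keys (\<Prod>y\<in>J. 1 - rvar y)"
    using insert by (intro insert.IH) auto
  define a :: "'a literal \<Rightarrow>\<^sub>0 nat" where "a = (if y \<in> S then Poly_Mapping.single y 1 else 0)"
  have a: "lit_monom S = a + lit_monom (S - {y})"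
    using fin by (auto simp: a_def lit_monom_def sum.remove)
  have "a \<in> Poly_Mapping.keys (1 - rvar y)"
    by (auto simp: a_def in_keys_iff lookup_minus lookup_rvar lookup_one when_def)
  from alternating_keys_mult[OF alternating_one_minus_rvar alternating_prod[OF alternating_one_minus_rvar] this IH]
  show ?case using insert a by simp
qed

lemma lookup_clause_poly:
  assumes "finite C"
  shows "Poly_Mapping.lookup (clause_poly C) m =
    (\<Sum>l\<in>C. if m = Poly_Mapping.single l 1 then 1 else 0) - (if m = 0 then 1 else 0)"
  by (simp add: clause_poly_def lookup_minus lookup_sum lookup_rvar lookup_one when_def)

lemma zero_in_keys_clause_poly: "finite C \<Longrightarrow> 0 \<in> Poly_Mapping.keys (clause_poly C)"
  by (auto simp: in_keys_iff lookup_clause_poly)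

lemma literal_in_keys_clause_poly:
  assumes "finite C" "l \<in> C"
  shows "Poly_Mapping.single l 1 \<in> Poly_Mapping.keys (clause_poly C)"
  using assms by (simp add: in_keys_iff lookup_clause_poly)

lemma lits_clause_poly: "lits (clause_poly C) \<subseteq> C"
  unfolding clause_poly_def
  using lits_diff[of "\<Sum>l\<in>C. rvar l" 1] lits_sum[of rvar C] by (auto simp: lits_one lits_rvar)

lemma alternating_clause_poly:
  assumes "finite C"
  shows "alternating (- 1) (clause_poly C)"
  unfolding alternating_def lookup_clause_poly[OF assms]
  by (auto simp: right_diff_distrib sum_distrib_left sum_distrib_right intro!: sum_nonneg)

text \<open>In each axiom, monomials of even degree have one sign and monomials of odd degree the
  opposite one.\<close>

lemma alternating_sar_axiom:
  assumes "b \<in> sar_axioms F" "\<And>C. C \<in> F \<Longrightarrow> finite C"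
  shows "\<exists>s. alternating s b"
  using assms(1)
proof cases
  case (clause C)
  then show ?thesis using alternating_clause_poly assms(2) by auto
next
  case (bool_lower y)
  then show ?thesis
    by (intro exI[of _ 1]) (auto simp: alternating_def lookup_minus lookup_rvar lookup_rvar_sq)
next
  case (bool_upper y)
  then show ?thesis
    by (intro exI[of _ "- 1"]) (auto simp: alternating_def lookup_minus lookup_rvar lookup_rvar_sq)
next
  case (compl_lower x)
  then show ?thesis
    by (intro exI[of _ 1]) (auto simp: alternating_def lookup_minus lookup_rvar lookup_one when_def)
next
  case (compl_upper x)
  then show ?thesis
    by (intro exI[of _ "- 1"]) (auto simp: alternating_def lookup_minus lookup_add lookup_rvar lookup_one when_def)
next
  case one
  then show ?thesis
    by (intro exI[of _ 1]) (auto simp: alternating_def lookup_one when_def)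
qed

text \<open>This bridges the size measure and the pseudo-expectation: a suitable choice of cofactors
  and of a monomial of the axiom is guaranteed to be among the counted terms.\<close>

lemma monom_in_keys_term_poly:
  assumes "finite (factors t)" "finite (cofactors t)" "S \<subseteq> cofactors t"
    and "alternating s (base t)" "m \<in> Poly_Mapping.keys (base t)"
  shows "lit_monom (factors t) + lit_monom S + m \<in> Poly_Mapping.keys (term_poly t)"
proof -
  have I: "lit_monom (factors t) \<in> Poly_Mapping.keys (lit_prod (factors t))"
    using assms by (simp add: lit_prod_eq_lit_monom)
  have J: "alternating 1 (\<Prod>y\<in>cofactors t. 1 - rvar y)"
    by (intro alternating_prod alternating_one_minus_rvar)
  note IJ = alternating_mult[OF alternating_lit_prod[OF assms(1)] J]
    alternating_keys_mult[OF alternating_lit_prod[OF assms(1)] J I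
      lit_monom_in_keys_cofactor_prod[OF assms(2,3)]]
  show ?thesis
    using alternating_keys_mult[OF IJ(1) assms(4) IJ(2) assms(5)]
    by (simp add: term_poly_def lit_prod_def)
qed

section \<open>Counting sets with dependencies\<close>

text \<open>The set is recovered from its part outside \<open>W\<close> by recursion on the index,
  because membership of \<open>v\<close> depends on a smaller element only.\<close>

lemma inj_on_Diff_below:
  fixes u :: "nat \<Rightarrow> nat"
  assumes "\<And>v. v \<in> W \<Longrightarrow> u v < v"
    and det: "\<And>v \<omega> \<omega>'. v \<in> W \<Longrightarrow> \<omega> \<in> S \<Longrightarrow> \<omega>' \<in> S \<Longrightarrow> (u v \<in> \<omega> \<longleftrightarrow> u v \<in> \<omega>') \<Longrightarrow>
      (v \<in> \<omega> \<longleftrightarrow> v \<in> \<omega>')"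
  shows "inj_on (\<lambda>\<omega>. \<omega> - W) S"
proof (rule inj_onI)
  fix \<omega> \<omega>' assume \<omega>: "\<omega> \<in> S" "\<omega>' \<in> S" "\<omega> - W = \<omega>' - W"
  have "v \<in> \<omega> \<longleftrightarrow> v \<in> \<omega>'" for v
  proof (induction v rule: less_induct)
    case (less v)
    then show ?case using assms \<omega> by (cases "v \<in> W") blast+
  qed
  then show "\<omega> = \<omega>'" by blast
qed

lemma inj_on_Diff_above:
  fixes u :: "nat \<Rightarrow> nat"
  assumes "\<And>v. v \<in> W \<Longrightarrow> v < u v" and U: "finite U" "W \<subseteq> U" "S \<subseteq> Pow U"
    and det: "\<And>v \<omega> \<omega>'. v \<in> W \<Longrightarrow> \<omega> \<in> S \<Longrightarrow> \<omega>' \<in> S \<Longrightarrow> (u v \<in> \<omega> \<longleftrightarrow> u v \<in> \<omega>') \<Longrightarrow>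
      (v \<in> \<omega> \<longleftrightarrow> v \<in> \<omega>')"
  shows "inj_on (\<lambda>\<omega>. \<omega> - W) S"
proof (rule inj_onI)
  fix \<omega> \<omega>' assume \<omega>: "\<omega> \<in> S" "\<omega>' \<in> S" "\<omega> - W = \<omega>' - W"
  \<comment> \<open>The recursion now runs downward, so it needs the upper bound that finiteness of
    \<open>U\<close> provides.\<close>
  obtain N where N: "\<And>v. v \<in> U \<Longrightarrow> v < N" using U(1) finite_nat_set_iff_bounded by auto
  have "v \<in> \<omega> \<longleftrightarrow> v \<in> \<omega>'" for v
  proof (induction "N - v" arbitrary: v rule: less_induct)
    case less
    show ?case
    proof (cases "v \<in> W")
      case True
      then have "N - u v < N - v" using N assms(1) U(2) by (meson diff_less_mono2 subsetD)
      then show ?thesis using less True det[OF True \<omega>(1,2)] by blast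
    next
      case False
      then show ?thesis using \<omega>(3) by blast
    qed
  qed
  then show "\<omega> = \<omega>'" by blast
qed

text \<open>Orient each dependency \<open>v \<rightarrow> u v\<close> by the order of the indices. The elements whose dependency
  points in the more popular of the two directions are determined one after the other by the rest
  of the set, so half of \<open>B\<close> carries no freedom.\<close>

lemma card_determined_sets:
  fixes U :: "nat set"
  assumes "finite U" "B \<subseteq> U" "S \<subseteq> Pow U"
    and det: "\<And>v. v \<in> B \<Longrightarrow> \<exists>u. u \<noteq> v \<and> (\<forall>\<omega>\<in>S. \<forall>\<omega>'\<in>S. (u \<in> \<omega> \<longleftrightarrow> u \<in> \<omega>') \<longrightarrow> (v \<in> \<omega> \<longleftrightarrow> v \<in> \<omega>'))"
  shows "\<exists>w. card B \<le> 2 * w \<and> card S * 2 ^ w \<le> 2 ^ card U"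
proof -
  have "\<exists>u. \<forall>v\<in>B. u v \<noteq> v \<and> (\<forall>\<omega>\<in>S. \<forall>\<omega>'\<in>S. (u v \<in> \<omega> \<longleftrightarrow> u v \<in> \<omega>') \<longrightarrow> (v \<in> \<omega> \<longleftrightarrow> v \<in> \<omega>'))"
    by (rule bchoice, rule ballI, rule det)
  then obtain u where u: "\<forall>v\<in>B. u v \<noteq> v \<and>
      (\<forall>\<omega>\<in>S. \<forall>\<omega>'\<in>S. (u v \<in> \<omega> \<longleftrightarrow> u v \<in> \<omega>') \<longrightarrow> (v \<in> \<omega> \<longleftrightarrow> v \<in> \<omega>'))" ..
  have u1: "u v \<noteq> v" if "v \<in> B" for v
    using bspec[OF u that] by (rule conjunct1)
  have u2: "v \<in> \<omega> \<longleftrightarrow> v \<in> \<omega>'" if "v \<in> B" "\<omega> \<in> S" "\<omega>' \<in> S" "u v \<in> \<omega> \<longleftrightarrow> u v \<in> \<omega>'" for v \<omega> \<omega>'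
    by (rule mp[OF bspec[OF bspec[OF conjunct2[OF bspec[OF u that(1)]] that(2)] that(3)] that(4)])
  have *: "card S * 2 ^ card W \<le> 2 ^ card U" if W: "W \<subseteq> B" "inj_on (\<lambda>\<omega>. \<omega> - W) S" for W
  proof -
    have WU: "W \<subseteq> U" using W(1) assms(2) by (rule subset_trans)
    note fW = finite_subset[OF WU assms(1)] WU
    have "card S \<le> card (Pow (U - W))"
      using assms(1,3) W(2) by (intro card_inj_on_le[of "\<lambda>\<omega>. \<omega> - W"]) auto
    then have "card S * 2 ^ card W \<le> 2 ^ card (U - W) * 2 ^ card W"
      using assms(1) by (simp add: card_Pow)
    also have "\<dots> = 2 ^ card U"
      using fW assms(1) card_mono[OF assms(1) fW(2)]
      by (simp add: card_Diff_subset power_add[symmetric])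
    finally show ?thesis .
  qed
  define W1 W2 where "W1 = {v \<in> B. u v < v}" and "W2 = {v \<in> B. v < u v}"
  have "B = W1 \<union> W2" using u1[unfolded nat_neq_iff] by (auto simp: W1_def W2_def)
  then have "card B \<le> card W1 + card W2" by (simp add: card_Un_le)
  moreover have "card S * 2 ^ card W1 \<le> 2 ^ card U"
  proof (rule *)
    show "inj_on (\<lambda>\<omega>. \<omega> - W1) S"
    proof (rule inj_on_Diff_below[where u = u])
      fix v \<omega> \<omega>' assume h: "v \<in> W1" "\<omega> \<in> S" "\<omega>' \<in> S" "u v \<in> \<omega> \<longleftrightarrow> u v \<in> \<omega>'"
      show "v \<in> \<omega> \<longleftrightarrow> v \<in> \<omega>'"
        by (rule u2[OF _ h(2-4)]) (use h(1) in \<open>simp add: W1_def\<close>)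
    qed (simp add: W1_def)
  qed (auto simp: W1_def)
  moreover have "card S * 2 ^ card W2 \<le> 2 ^ card U"
  proof (rule *)
    show "inj_on (\<lambda>\<omega>. \<omega> - W2) S"
    proof (rule inj_on_Diff_above[where u = u and U = U])
      fix v \<omega> \<omega>' assume h: "v \<in> W2" "\<omega> \<in> S" "\<omega>' \<in> S" "u v \<in> \<omega> \<longleftrightarrow> u v \<in> \<omega>'"
      show "v \<in> \<omega> \<longleftrightarrow> v \<in> \<omega>'"
        by (rule u2[OF _ h(2-4)]) (use h(1) in \<open>simp add: W2_def\<close>)
    next
      show "W2 \<subseteq> U" using assms(2) by (auto simp: W2_def)
    qed (simp_all add: W2_def assms(1,3))
  qed (auto simp: W2_def)
  ultimately have "(card B \<le> 2 * card W1 \<and> card S * 2 ^ card W1 \<le> 2 ^ card U) \<or>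
      (card B \<le> 2 * card W2 \<and> card S * 2 ^ card W2 \<le> 2 ^ card U)"
    by linarith
  then show ?thesis by blast
qed

text \<open>The left side is a single term in the expansion of ((1 - x) + x)^m.\<close>

lemma binomial_mult_power_le:
  fixes x :: real
  assumes "0 \<le> x" "x \<le> 1" "k \<le> m"
  shows "real (m choose k) * x ^ (m - k) * (1 - x) ^ k \<le> 1"
proof -
  have "real (m choose k) * (1 - x) ^ k * x ^ (m - k) \<le>
      (\<Sum>j\<le>m. real (m choose j) * (1 - x) ^ j * x ^ (m - j))"
    using assms by (intro member_le_sum[of k "{..m}" "\<lambda>j. real (m choose j) * (1 - x) ^ j * x ^ (m - j)"]) auto
  also have "\<dots> = 1"
    using binomial_ring[of "1 - x" x m] by simp
  finally show ?thesis by (simp add: mult.commute mult.left_commute)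
qed

text \<open>The bound \<open>x ^ 2 \<ge> 1 / 2\<close> turns the loss of a factor \<open>2\<close> per two elements into a factor
  \<open>x\<close> per element.\<close>

lemma sum_card_supersets_le:
  fixes x :: real
  assumes "finite U" "M \<subseteq> U" "1 / 2 \<le> x ^ 2" "0 < x" "x < 1"
    and S: "\<And>A. A \<subseteq> M \<Longrightarrow> card A = k \<Longrightarrow> \<exists>w. card (M - A) \<le> 2 * w \<and> card (S A) * 2 ^ w \<le> 2 ^ card U"
  shows "real (\<Sum>A | A \<subseteq> M \<and> card A = k. card (S A)) * (1 - x) ^ k \<le> 2 ^ card U"
proof (cases "k \<le> card M")
  case False
  have "{A. A \<subseteq> M \<and> card A = k} = {}"
    using False card_mono[OF finite_subset[OF assms(2,1)]] by auto
  then show ?thesis by (simp only: sum.empty) simp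
next
  case True
  note fM = finite_subset[OF assms(2,1)]
  have *: "real (card (S A)) \<le> 2 ^ card U * x ^ (card M - k)" if A: "A \<subseteq> M" "card A = k" for A
  proof -
    obtain w where w: "card (M - A) \<le> 2 * w" "card (S A) * 2 ^ w \<le> 2 ^ card U"
      using S[OF A] by (elim exE conjE) (rule that)
    have cM: "card (M - A) = card M - k"
      using A fM by (simp add: card_Diff_subset finite_subset)
    have "(1 / 2) ^ w \<le> (x ^ 2) ^ w" using assms(3) by (intro power_mono) auto
    also have "\<dots> = x ^ (2 * w)" by (simp add: power_mult)
    also have "\<dots> \<le> x ^ (card M - k)" using w(1) assms(4,5) cM by (intro power_decreasing) auto
    finally have "(1 / 2) ^ w \<le> x ^ (card M - k)" .
    moreover have "real (card (S A)) \<le> 2 ^ card U * (1 / 2) ^ w"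
    proof -
      have "real (card (S A)) * 2 ^ w \<le> 2 ^ card U"
        using of_nat_mono[OF w(2), where 'a = real] by simp
      then show ?thesis by (simp add: power_one_over field_simps)
    qed
    ultimately show ?thesis by (meson mult_left_mono order_trans zero_le_numeral zero_le_power)
  qed
  have "real (\<Sum>A | A \<subseteq> M \<and> card A = k. card (S A)) \<le>
      (\<Sum>A | A \<subseteq> M \<and> card A = k. 2 ^ card U * x ^ (card M - k))"
    using * by (simp only: of_nat_sum) (intro sum_mono, auto)
  also have "\<dots> = 2 ^ card U * (real (card M choose k) * x ^ (card M - k))"
    using n_subsets[OF fM] by simp
  finally have "real (\<Sum>A | A \<subseteq> M \<and> card A = k. card (S A)) * (1 - x) ^ k \<le>
      2 ^ card U * (real (card M choose k) * x ^ (card M - k)) * (1 - x) ^ k"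
    using assms(5) by (intro mult_right_mono) auto
  also have "\<dots> \<le> 2 ^ card U * 1"
    using binomial_mult_power_le[of x k "card M"] True assms(4,5)
    by (simp only: mult.assoc) (intro mult_left_mono, simp_all add: mult.assoc)
  finally show ?thesis by simp
qed

section \<open>The pseudo-expectation\<close>

lemma erphp_cases [consumes 1]:
  assumes "C \<in> erphp k n"
  obtains (pigeon_first) u where "u \<in> {1..k}" "C = {Pos (P u 1), Pos (P u 2), Pos (Y u 2)}"
  | (pigeon_mid) u v where "u \<in> {1..k}" "v \<in> {2..n - 3}"
      "C = {Neg (Y u v), Pos (P u (v + 1)), Pos (Y u (v + 1))}"
  | (pigeon_last) u where "u \<in> {1..k}" "C = {Neg (Y u (n - 2)), Pos (P u (n - 1)), Pos (P u n)}"
  | (hole_first) v where "v \<in> {1..n}" "C = {Neg (R v), Pos (Q v 1), Pos (Z v 1)}"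
  | (hole_mid) v w where "v \<in> {1..n}" "w \<in> {1..k - 4}"
      "C = {Neg (Z v w), Pos (Q v (w + 1)), Pos (Z v (w + 1))}"
  | (hole_last) v where "v \<in> {1..n}" "C = {Neg (Z v (k - 3)), Pos (Q v (k - 2)), Pos (Q v (k - 1))}"
  | (place_inj) u u' v where "u \<in> {1..k}" "u' \<in> {1..k}" "u \<noteq> u'" "v \<in> {1..n}"
      "C = {Neg (P u v), Neg (P u' v)}"
  | (in_use) u v where "u \<in> {1..k}" "v \<in> {1..n}" "C = {Neg (P u v), Pos (R v)}"
  | (both_in_use) v v' where "v \<in> {1..n}" "v' \<in> {1..n}" "v \<noteq> v'"
      "C = {Neg (R v), Neg (R v'), Pos (RR v v')}"
  | (hole_inj) v v' w where "v \<in> {1..n}" "v' \<in> {1..n}" "v \<noteq> v'" "w \<in> {1..k - 1}"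
      "C = {Neg (RR v v'), Neg (Q v w), Neg (Q v' w)}"
  using assms unfolding erphp_def
  apply (elim UnE CollectE exE conjE)
  subgoal by (rule that(1))
  subgoal by (rule that(2))
  subgoal by (rule that(3))
  subgoal by (rule that(4))
  subgoal by (rule that(5))
  subgoal by (rule that(6))
  subgoal by (rule that(7))
  subgoal by (rule that(8))
  subgoal by (rule that(9))
  subgoal by (rule that(10))
  done

lemma finite_erphp_clause: "C \<in> erphp k n \<Longrightarrow> finite C"
  by (cases rule: erphp_cases) auto

section \<open>Evaluation at total assignments\<close>

fun lit_true :: "('a \<Rightarrow> bool) \<Rightarrow> 'a literal \<Rightarrow> bool" where
  "lit_true \<tau> (Pos x) \<longleftrightarrow> \<tau> x"
| "lit_true \<tau> (Neg x) \<longleftrightarrow> \<not> \<tau> x"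

text \<open>Twins receive complementary values, so \<open>lin (val \<tau>)\<close> is evaluation at
  a genuine 0/1 assignment. On terms it is nonnegative as soon as it is so on the axiom.\<close>

definition val :: "('a \<Rightarrow> bool) \<Rightarrow> ('a literal \<Rightarrow>\<^sub>0 nat) \<Rightarrow> real" where
  "val \<tau> m = of_bool (\<forall>l\<in>Poly_Mapping.keys m. lit_true \<tau> l)"

lemma val_zero [simp]: "val \<tau> 0 = 1"
  by (simp add: val_def)

lemma val_single_add: "val \<tau> (Poly_Mapping.single y 1 + m) = of_bool (lit_true \<tau> y) * val \<tau> m"
  by (simp add: val_def keys_add_nat)

lemma lin_val_rvar_mult: "lin (val \<tau>) (rvar y * p) = of_bool (lit_true \<tau> y) * lin (val \<tau>) p"
  by (simp only: lin_rvar_mult val_single_add lin_scale)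

lemma lin_val_rvar: "lin (val \<tau>) (rvar y) = of_bool (lit_true \<tau> y)"
  using lin_val_rvar_mult[of \<tau> y 1] by (simp add: lin_one)

lemma lin_val_cofactor_mult:
  "lin (val \<tau>) ((1 - rvar y) * p) = (1 - of_bool (lit_true \<tau> y)) * lin (val \<tau>) p"
  by (simp add: left_diff_distrib lin_diff lin_val_rvar_mult)

lemma lin_val_factors_nonneg:
  "0 \<le> lin (val \<tau>) p \<Longrightarrow> 0 \<le> lin (val \<tau>) ((\<Prod>y\<in>I. rvar y) * p)"
  by (induction I rule: infinite_finite_induct) (simp_all add: mult.assoc lin_val_rvar_mult)

lemma lin_val_cofactors_nonneg:
  "0 \<le> lin (val \<tau>) p \<Longrightarrow> 0 \<le> lin (val \<tau>) ((\<Prod>y\<in>J. 1 - rvar y) * p)"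
  by (induction J rule: infinite_finite_induct) (simp_all add: mult.assoc lin_val_cofactor_mult)

lemma lin_val_term_nonneg: "0 \<le> lin (val \<tau>) (base t) \<Longrightarrow> 0 \<le> lin (val \<tau>) (term_poly t)"
  unfolding term_poly_def mult.assoc by (intro lin_val_factors_nonneg lin_val_cofactors_nonneg)

lemma lin_val_clause_nonneg:
  assumes "finite C" "l \<in> C" "lit_true \<tau> l"
  shows "0 \<le> lin (val \<tau>) (clause_poly C)"
proof -
  have "of_bool (lit_true \<tau> l) \<le> (\<Sum>l\<in>C. of_bool (lit_true \<tau> l) :: real)"
    using assms(1,2) by (intro member_le_sum[of l C "\<lambda>l. of_bool (lit_true \<tau> l)"]) auto
  then show ?thesis
    using assms(3) by (simp add: clause_poly_def lin_diff lin_sum lin_val_rvar lin_one)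
qed

text \<open>An upper bound for the later \<open>active\<close> that does not depend on the
  restriction. The formula has no variable \<open>RR v v\<close>; the empty value there ensures that
  a pair always involves a second, different place.\<close>

fun mentions :: "erphp_var \<Rightarrow> nat set" where
  "mentions (Q v w) = {v}"
| "mentions (Z v w) = {v}"
| "mentions (RR v v') = (if v = v' then {} else {v, v'})"
| "mentions _ = {}"

text \<open>The bits \<omega> are arbitrary, so the locale predicate does not take them as an
  argument, whereas notions such as \<open>bad\<close> do.\<close>

locale restriction =
  fixes k n :: nat and A \<omega> :: "nat set" and \<pi> :: "nat \<Rightarrow> nat"
  assumes k: "4 \<le> k" and A: "A \<subseteq> {1..n}" and card_A: "card A = k"
    and \<pi>: "bij_betw \<pi> {1..k} A"
begin

text \<open>Pigeon \<open>u\<close> goes to place \<open>\<pi> u\<close> and on to hole \<open>g (\<pi> u)\<close>; hole \<open>k\<close> does not exist. A place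
  \<open>v\<close> outside of \<open>A\<close> sets all its variables \<open>Q v w\<close>, \<open>Z v w\<close> to the bit \<open>v \<in> \<omega>\<close>. Exclusive or makes
  every \<open>RR v v'\<close> sensitive to each bit it depends on, yet false whenever both places could use
  the same hole.\<close>

definition bit :: "nat \<Rightarrow> bool" where
  "bit v \<longleftrightarrow> v \<in> A \<or> v \<in> \<omega>"

fun asg :: "(nat \<Rightarrow> nat) \<Rightarrow> erphp_var \<Rightarrow> bool" where
  "asg g (P u v) \<longleftrightarrow> v = \<pi> u"
| "asg g (Y u v) \<longleftrightarrow> v < \<pi> u"
| "asg g (R v) \<longleftrightarrow> v \<in> A"
| "asg g (RR v v') \<longleftrightarrow> v \<in> A \<and> v' \<in> A \<or> bit v \<noteq> bit v'"
| "asg g (Q v w) \<longleftrightarrow> (if v \<in> A then g v = w else v \<in> \<omega>)"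
| "asg g (Z v w) \<longleftrightarrow> (if v \<in> A then w < g v else v \<in> \<omega>)"

text \<open>Although \<open>asg g\<close> makes \<open>RR v v'\<close> true for all \<open>v\<close>, \<open>v'\<close> in \<open>A\<close>, it counts as active: this is
  what makes monomials with \<open>k\<close> active places, not just \<open>k - 1\<close>, unavoidable.\<close>

fun active :: "erphp_var \<Rightarrow> nat set" where
  "active (Q v w) = A \<inter> {v}"
| "active (Z v w) = A \<inter> {v}"
| "active (RR v v') = (if v \<in> A \<and> v' \<in> A \<and> v \<noteq> v' then {v, v'} else {})"
| "active _ = {}"

definition act :: "erphp_var literal \<Rightarrow> nat set" where
  "act l = active (lit_var l)"

definition act_monom :: "(erphp_var literal \<Rightarrow>\<^sub>0 nat) \<Rightarrow> nat set" where
  "act_monom m = (\<Union>l\<in>Poly_Mapping.keys m. act l)"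

text \<open>This is meant for literals with empty \<open>act\<close>, whose value is the same under
  every hole map; the constant map 0 is just one of them.\<close>

definition fixed_true :: "erphp_var literal \<Rightarrow> bool" where
  "fixed_true l \<longleftrightarrow> lit_true (asg (\<lambda>_. 0)) l"

text \<open>On these monomials neither argument for nonnegativity works: there is no untouched place
  to average over, and no fixed literal annihilates them.\<close>

definition bad :: "(erphp_var literal \<Rightarrow>\<^sub>0 nat) \<Rightarrow> bool" where
  "bad m \<longleftrightarrow> A \<subseteq> act_monom m \<and> (\<forall>l\<in>Poly_Mapping.keys m. act l = {} \<longrightarrow> fixed_true l)"

text \<open>Sending \<open>i\<close> to the nonexistent hole \<open>k\<close> encodes a bijection of
  \<open>A - {i}\<close> with the \<open>k - 1\<close> real holes. Extensionality keeps the set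
  finite.\<close>

definition hole_maps :: "nat \<Rightarrow> (nat \<Rightarrow> nat) set" where
  "hole_maps i = {g \<in> A \<rightarrow>\<^sub>E {1..k}. bij_betw g A {1..k} \<and> g i = k}"

text \<open>The average is left unnormalized: a contradiction needs only that the value at the
  monomial 1 is positive.\<close>

definition expect :: "nat \<Rightarrow> (erphp_var literal \<Rightarrow>\<^sub>0 nat) \<Rightarrow> real" where
  "expect i m = (\<Sum>g\<in>hole_maps i. val (asg g) m)"

definition pseudo :: "(erphp_var literal \<Rightarrow>\<^sub>0 nat) \<Rightarrow> real" where
  "pseudo m = (if A \<subseteq> act_monom m then 0 else expect (SOME i. i \<in> A - act_monom m) m)"

section \<open>Properties of the pseudo-expectation\<close>

lemma finite_A: "finite A"
  using A finite_subset by blast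

lemma active_subset_mentions: "active x \<subseteq> mentions x"
  by (cases x) auto

lemma act_monom_single_add: "act_monom (Poly_Mapping.single y 1 + m) = act y \<union> act_monom m"
  by (simp add: act_monom_def keys_add_nat)

lemma asg_cong: "(\<And>v. v \<in> active x \<Longrightarrow> g v = g' v) \<Longrightarrow> asg g x \<longleftrightarrow> asg g' x"
  by (cases x) auto

lemma lit_true_asg_cong: "(\<And>v. v \<in> act l \<Longrightarrow> g v = g' v) \<Longrightarrow> lit_true (asg g) l \<longleftrightarrow> lit_true (asg g') l"
  using asg_cong[of "lit_var l" g g'] by (cases l) (auto simp: act_def)

lemma lit_true_eq_fixed_true: "act l = {} \<Longrightarrow> lit_true (asg g) l \<longleftrightarrow> fixed_true l"
  unfolding fixed_true_def by (rule lit_true_asg_cong) simp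

lemma finite_hole_maps: "finite (hole_maps i)"
proof -
  have "finite (A \<rightarrow>\<^sub>E {1..k})" using finite_A by (intro finite_PiE) auto
  then show ?thesis by (rule rev_finite_subset) (auto simp: hole_maps_def)
qed

text \<open>Start from any bijection and exchange \<open>i\<close> with the place that is sent to
  \<open>k\<close>.\<close>

lemma hole_maps_nonempty:
  assumes "i \<in> A"
  shows "hole_maps i \<noteq> {}"
proof -
  obtain h where h: "bij_betw h A {1..k}"
    using finite_same_card_bij[OF finite_A, of "{1..k}"] card_A by auto
  then have "k \<in> h ` A" using k by (simp add: bij_betw_def)
  then obtain j where j: "j \<in> A" "h j = k" by auto
  define g where "g = restrict (h \<circ> Transposition.transpose i j) A"
  have "bij_betw (h \<circ> Transposition.transpose i j) A {1..k}"
    using assms j h by (intro bij_betw_trans[OF _ h]) (simp add: bij_betw_transpose_iff)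
  then have g: "bij_betw g A {1..k}"
    unfolding g_def by (simp cong: bij_betw_cong)
  then have "g \<in> hole_maps i"
    using assms j bij_betw_imp_funcset[OF g] by (auto simp: hole_maps_def g_def PiE_def)
  then show ?thesis by blast
qed

lemma transpose_hole_maps:
  assumes "i \<in> A" "j \<in> A" "g \<in> hole_maps i"
  shows "g \<circ> Transposition.transpose i j \<in> hole_maps j"
proof -
  have t: "bij_betw (Transposition.transpose i j) A A"
    using assms by (simp add: bij_betw_transpose_iff)
  have g: "bij_betw g A {1..k}" "g i = k" "g \<in> A \<rightarrow>\<^sub>E {1..k}" using assms(3) by (auto simp: hole_maps_def)
  have b: "bij_betw (g \<circ> Transposition.transpose i j) A {1..k}" by (rule bij_betw_trans[OF t g(1)])
  have "(g \<circ> Transposition.transpose i j) v = undefined" if "v \<notin> A" for v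
    using that assms g(3) by (metis PiE_arb comp_apply transpose_apply_other)
  then show ?thesis
    using b g(2) bij_betw_imp_funcset[OF b] by (auto simp: hole_maps_def PiE_def extensional_def)
qed

text \<open>Composition with the transposition of \<open>i\<close> and \<open>j\<close> exchanges
  the two sets of hole maps and leaves the values of all literals that touch neither place
  unchanged.\<close>

lemma expect_independent:
  assumes "i \<in> A - act_monom m" "j \<in> A - act_monom m"
  shows "expect i m = expect j m"
  unfolding expect_def
proof (rule sum.reindex_bij_witness[of _ "\<lambda>g. g \<circ> Transposition.transpose i j" "\<lambda>g. g \<circ> Transposition.transpose i j"])
  fix g
  have "lit_true (asg (g \<circ> Transposition.transpose i j)) l \<longleftrightarrow> lit_true (asg g) l"
    if "l \<in> Poly_Mapping.keys m" for l
  proof (rule lit_true_asg_cong)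
    fix v assume "v \<in> act l"
    then have "v \<noteq> i" "v \<noteq> j" using that assms by (auto simp: act_monom_def)
    then show "(g \<circ> Transposition.transpose i j) v = g v" by simp
  qed
  then show "val (asg (g \<circ> Transposition.transpose i j)) m = val (asg g) m"
    by (simp add: val_def)
next
  fix g assume "g \<in> hole_maps j"
  then show "g \<circ> Transposition.transpose i j \<in> hole_maps i"
    using transpose_hole_maps[of j i g] assms by (simp add: transpose_commute)
qed (use assms transpose_hole_maps in \<open>auto simp: comp_assoc\<close>)

lemma pseudo_eq_expect:
  assumes "i \<in> A - act_monom m"
  shows "pseudo m = expect i m"
proof -
  have *: "(SOME i. i \<in> A - act_monom m) \<in> A - act_monom m"
    using assms by (rule someI)
  have "\<not> A \<subseteq> act_monom m" using assms by blast
  then have "pseudo m = expect (SOME i. i \<in> A - act_monom m) m"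
    unfolding pseudo_def by (rule if_not_P)
  also have "\<dots> = expect i m" by (rule expect_independent[OF * assms])
  finally show ?thesis .
qed

lemma pseudo_keys_cong:
  "Poly_Mapping.keys m = Poly_Mapping.keys m' \<Longrightarrow> pseudo m = pseudo m'"
  by (simp add: pseudo_def expect_def val_def act_monom_def)

text \<open>A fixed literal touches no place, so the case distinction in \<open>pseudo\<close> and
  the place chosen there stay the same.\<close>

lemma pseudo_fixed_true:
  assumes "act y = {}" "fixed_true y"
  shows "pseudo (Poly_Mapping.single y 1 + m) = pseudo m"
  unfolding pseudo_def expect_def act_monom_single_add val_single_add
  using assms by (simp add: lit_true_eq_fixed_true)

lemma pseudo_fixed_false:
  assumes "act y = {}" "\<not> fixed_true y"
  shows "pseudo (Poly_Mapping.single y 1 + m) = 0"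
  unfolding pseudo_def expect_def act_monom_single_add val_single_add
  using assms by (simp add: lit_true_eq_fixed_true)

text \<open>The one clause that can fail is the last of the chain for the hole of \<open>i\<close>,
  as hole \<open>k\<close> does not exist. It touches \<open>i\<close>, which the assumption rules
  out.\<close>

lemma asg_satisfies_clause:
  assumes "C \<in> erphp k n" "i \<in> A" "g \<in> hole_maps i" "i \<notin> (\<Union>l\<in>C. act l)"
  shows "\<exists>l\<in>C. lit_true (asg g) l"
proof -
  have gA: "1 \<le> g v" "g v \<le> k" if "v \<in> A" for v
    using assms(3) that by (auto simp: hole_maps_def PiE_iff)
  have g_inj: "v = v'" if "v \<in> A" "v' \<in> A" "g v = g v'" for v v'
    using assms(3) that by (auto simp: hole_maps_def bij_betw_def inj_on_def)
  have gi: "g i = k" using assms(3) by (simp add: hole_maps_def)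
  have \<pi>A: "\<pi> u \<in> A" "1 \<le> \<pi> u" "\<pi> u \<le> n" if "u \<in> {1..k}" for u
    using bspec[OF bij_betwE[OF \<pi>] that] subsetD[OF A, of "\<pi> u"] by auto
  have \<pi>_inj: "u = u'" if "u \<in> {1..k}" "u' \<in> {1..k}" "\<pi> u = \<pi> u'" for u u'
    by (rule inj_onD[OF bij_betw_imp_inj_on[OF \<pi>] that(3,1,2)])
  show ?thesis
    using assms(1)
  proof (cases rule: erphp_cases)
    case (pigeon_first u)
    then show ?thesis using \<pi>A[of u] by auto
  next
    case (pigeon_mid u v)
    then show ?thesis by auto
  next
    case (pigeon_last u)
    then show ?thesis using \<pi>A[of u] by auto
  next
    case (hole_first v)
    then show ?thesis using gA[of v] by auto
  next
    case (hole_mid v w)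
    then show ?thesis by auto
  next
    case (hole_last v)
    show ?thesis
    proof (cases "v \<in> A")
      case True
      then have "v \<noteq> i" using assms(4) hole_last by (auto simp: act_def)
      then have "g v \<noteq> k" using g_inj[OF True assms(2)] gi by auto
      then show ?thesis using True gA[OF True] hole_last by auto
    next
      case False
      then show ?thesis using hole_last by auto
    qed
  next
    case (place_inj u u' v)
    then show ?thesis using \<pi>_inj[of u u'] by auto
  next
    case (in_use u v)
    then show ?thesis using \<pi>A[of u] by auto
  next
    case (both_in_use v v')
    then show ?thesis by auto
  next
    \<comment> \<open>If both places are in \<open>A\<close>, injectivity of \<open>g\<close>
      applies. Otherwise \<open>RR v v'\<close> is true only for different bits, and the place with
      bit 0 lies outside \<open>A\<close> and has all its \<open>Q\<close> variables false.\<close>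
    case (hole_inj v v' w)
    then show ?thesis using g_inj[of v v'] by (auto simp: bit_def)
  qed
qed

text \<open>For a hole clause with both places in \<open>A\<close> the literal on
  \<open>RR v v'\<close> touches everything, since it counts as active. With one place in
  \<open>A\<close>, a \<open>Q\<close> literal does.\<close>

lemma clause_act_attained:
  assumes "C \<in> erphp k n"
  shows "(\<Union>l\<in>C. act l) = {} \<or> (\<exists>l\<in>C. act l = (\<Union>l\<in>C. act l))"
  using assms by (cases rule: erphp_cases) (auto simp: act_def)

text \<open>The monomial \<mu> witnesses that whatever the axiom touches is touched by one of its
  monomials free of false fixed literals; it is the constant one when nothing is touched. Boolean
  axioms stand apart because they have no constant monomial to use when \<open>y\<close> is fixed to
  false.\<close>

lemma axiom_support:
  assumes "b \<in> sar_axioms (erphp k n)"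
  obtains y where "b = rvar y ^ 2 - rvar y \<or> b = rvar y - rvar y ^ 2"
  | B \<mu> where "lits b \<subseteq> B" "\<mu> \<in> Poly_Mapping.keys b" "(\<Union>l\<in>B. act l) \<subseteq> act_monom \<mu>"
      "\<And>l. l \<in> Poly_Mapping.keys \<mu> \<Longrightarrow> act l = {} \<Longrightarrow> fixed_true l"
      "\<And>i g. i \<in> A \<Longrightarrow> i \<notin> (\<Union>l\<in>B. act l) \<Longrightarrow> g \<in> hole_maps i \<Longrightarrow> 0 \<le> lin (val (asg g)) b"
  using assms
proof cases
  case (clause C)
  have fin: "finite C" by (rule finite_erphp_clause) (rule clause)
  have nn: "0 \<le> lin (val (asg g)) b" if i: "i \<in> A" "i \<notin> (\<Union>l\<in>C. act l)" "g \<in> hole_maps i" for i g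
  proof -
    obtain l where "l \<in> C" "lit_true (asg g) l"
      using asg_satisfies_clause[OF clause(2) i(1,3,2)] by blast
    then show ?thesis unfolding clause(1) by (rule lin_val_clause_nonneg[OF fin])
  qed
  show ?thesis
  proof (cases "(\<Union>l\<in>C. act l) = {}")
    case True
    show ?thesis
      by (rule that(2)[of C 0])
         (use True nn lits_clause_poly[of C] zero_in_keys_clause_poly[OF fin] clause(1) in \<open>auto simp: act_monom_def\<close>)
  next
    case False
    then obtain l where l: "l \<in> C" "act l = (\<Union>l\<in>C. act l)"
      using clause_act_attained[OF clause(2)] by blast
    show ?thesis
    proof (rule that(2)[of C "Poly_Mapping.single l 1"])
      show "Poly_Mapping.single l 1 \<in> Poly_Mapping.keys b"
        unfolding clause(1) by (rule literal_in_keys_clause_poly[OF fin l(1)])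
      show "(\<Union>l\<in>C. act l) \<subseteq> act_monom (Poly_Mapping.single l 1)"
        using l(2) by (simp add: act_monom_def)
    qed (use False l(2) nn lits_clause_poly[of C] clause(1) in auto)
  qed
next
  case (bool_lower y)
  then show ?thesis using that(1) by blast
next
  case (bool_upper y)
  then show ?thesis using that(1) by blast
next
  case (compl_lower x)
  have lin: "lin (val \<tau>) b = 0" for \<tau>
    by (simp add: compl_lower lin_diff lin_one lin_val_rvar)
  have lits: "lits b \<subseteq> {Pos x, Neg x}"
    using lits_diff[of "1 - rvar (Pos x)" "rvar (Neg x)"] lits_diff[of 1 "rvar (Pos x)"]
    by (auto simp: compl_lower lits_one lits_rvar)
  have keys: "0 \<in> Poly_Mapping.keys b" "Poly_Mapping.single (Pos x) 1 \<in> Poly_Mapping.keys b"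
    by (auto simp: compl_lower in_keys_iff lookup_minus lookup_rvar lookup_one)
  show ?thesis
    by (cases "active x = {}";
        rule that(2)[of "{Pos x, Neg x}" "if active x = {} then 0 else Poly_Mapping.single (Pos x) 1"])
       (use lin lits keys in \<open>auto simp: act_monom_def act_def\<close>)
next
  case (compl_upper x)
  have lin: "lin (val \<tau>) b = 0" for \<tau>
    by (simp add: compl_upper lin_add lin_diff lin_minus lin_one lin_val_rvar)
  have lits: "lits b \<subseteq> {Pos x, Neg x}"
    using lits_add[of "- 1 + rvar (Pos x)" "rvar (Neg x)"] lits_add[of "- 1" "rvar (Pos x)"]
    by (auto simp: compl_upper lits_def rvar_def)
  have keys: "0 \<in> Poly_Mapping.keys b" "Poly_Mapping.single (Pos x) 1 \<in> Poly_Mapping.keys b"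
    by (auto simp: compl_upper in_keys_iff lookup_add lookup_minus lookup_rvar lookup_one)
  show ?thesis
    by (cases "active x = {}";
        rule that(2)[of "{Pos x, Neg x}" "if active x = {} then 0 else Poly_Mapping.single (Pos x) 1"])
       (use lin lits keys in \<open>auto simp: act_monom_def act_def\<close>)
next
  case one
  then show ?thesis
    by (intro that(2)[of "{}" 0]) (auto simp: lits_one lin_one act_monom_def)
qed

text \<open>The pseudo-expectation ignores exponents, so terms with a Boolean axiom vanish exactly,
  whatever they touch.\<close>

lemma lin_pseudo_square: "lin pseudo (c * rvar y ^ 2) = lin pseudo (c * rvar y)"
proof -
  have "c * rvar y ^ 2 = rvar y * (rvar y * c)" "c * rvar y = rvar y * c"
    by (simp_all add: power2_eq_square mult_ac)
  moreover have "pseudo (Poly_Mapping.single y 1 + (Poly_Mapping.single y 1 + m)) =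
      pseudo (Poly_Mapping.single y 1 + m)" for m
    by (rule pseudo_keys_cong) (simp add: keys_add_nat)
  ultimately show ?thesis by (simp only: lin_rvar_mult)
qed

lemma lin_expect_nonneg:
  assumes "\<And>g. g \<in> hole_maps i \<Longrightarrow> 0 \<le> lin (val (asg g)) p"
  shows "0 \<le> lin (expect i) p"
proof -
  have "expect i = (\<lambda>m. \<Sum>g\<in>hole_maps i. val (asg g) m)"
    by (rule ext) (rule expect_def)
  then have "lin (expect i) p = (\<Sum>g\<in>hole_maps i. lin (val (asg g)) p)"
    by (simp only: lin_sum_functional)
  then show ?thesis using assms by (simp add: sum_nonneg)
qed

text \<open>A false fixed factor or a true fixed cofactor makes the term vanish. Otherwise, either
  the literals of the term leave some \<open>i\<close> of \<open>A\<close> untouched, and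
  \<open>pseudo\<close> is on all its monomials a sum of evaluations nonnegative on the axiom, or
  they touch all of \<open>A\<close>, and the expansion contains a bad monomial.\<close>

lemma lin_pseudo_term_nonneg:
  assumes t: "valid_term (erphp k n) t"
    and not_bad: "\<And>m. m \<in> Poly_Mapping.keys (term_poly t) \<Longrightarrow> \<not> bad m"
  shows "0 \<le> lin pseudo (term_poly t)"
proof -
  have fin: "finite (factors t)" "finite (cofactors t)" and ax: "base t \<in> sar_axioms (erphp k n)"
    using t by (auto simp: valid_term_def)
  consider (false) y where "y \<in> factors t" "act y = {}" "\<not> fixed_true y"
    | (true) y where "y \<in> cofactors t" "act y = {}" "fixed_true y"
    | (live) "\<forall>y\<in>factors t. act y = {} \<longrightarrow> fixed_true y" "\<forall>y\<in>cofactors t. act y = {} \<longrightarrow> \<not> fixed_true y"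
    by blast
  then show ?thesis
  proof cases
    case false
    have "term_poly t = rvar y * ((\<Prod>y\<in>factors t - {y}. rvar y) * (\<Prod>y\<in>cofactors t. 1 - rvar y) * base t)"
      unfolding term_poly_def using prod.remove[OF fin(1) false(1), of rvar] by (simp add: mult.assoc)
    then have "lin pseudo (term_poly t) = 0"
      using pseudo_fixed_false[OF false(2,3)] by (simp only: lin_rvar_mult) (simp add: lin_def)
    then show ?thesis by simp
  next
    case true
    have "term_poly t = (1 - rvar y) * ((\<Prod>y\<in>factors t. rvar y) * (\<Prod>y\<in>cofactors t - {y}. 1 - rvar y) * base t)"
      unfolding term_poly_def using prod.remove[OF fin(2) true(1), of "\<lambda>y. 1 - rvar y"] by (simp add: mult_ac)
    then have "lin pseudo (term_poly t) = 0"
      using pseudo_fixed_true[OF true(2,3)] by (simp only: left_diff_distrib lin_diff lin_rvar_mult) simp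
    then show ?thesis by simp
  next
    case live
    show ?thesis
      using ax
    proof (cases rule: axiom_support)
      case (1 y)
      have "lin pseudo (term_poly t) = 0"
        using 1 unfolding term_poly_def by (auto simp: right_diff_distrib lin_diff lin_pseudo_square)
      then show ?thesis by simp
    next
      case (2 B \<mu>)
      let ?D = "\<Union>l\<in>factors t \<union> cofactors t \<union> B. act l"
      show ?thesis
      proof (cases "A \<subseteq> ?D")
        case True
        obtain s where s: "alternating s (base t)"
          using alternating_sar_axiom[OF ax] finite_erphp_clause by blast
        \<comment> \<open>Cofactors that touch \<open>A\<close> contribute their literal. The fixed
          ones contribute 1, because their literals are false and would make the monomial
          die.\<close>
        define S where "S = {y \<in> cofactors t. act y \<noteq> {}}"
        define m where "m = lit_monom (factors t) + lit_monom S + \<mu>"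
        have m: "m \<in> Poly_Mapping.keys (term_poly t)"
          unfolding m_def using fin s 2(2) by (intro monom_in_keys_term_poly) (auto simp: S_def)
        have fS: "finite S" using fin by (simp add: S_def)
        have keys: "Poly_Mapping.keys m = factors t \<union> S \<union> Poly_Mapping.keys \<mu>"
          using fin fS by (simp add: m_def keys_add_nat keys_lit_monom)
        have "?D \<subseteq> act_monom m"
          using 2(3) unfolding act_monom_def keys by (auto simp: S_def)
        moreover have "fixed_true l" if "l \<in> Poly_Mapping.keys m" "act l = {}" for l
          using that live(1) 2(4)[of l] unfolding keys by (auto simp: S_def)
        ultimately have "bad m" unfolding bad_def using True by blast
        then show ?thesis using not_bad[OF m] by simp
      next
        case False
        then obtain i where i: "i \<in> A" "i \<notin> ?D" by blast
        have "pseudo m = expect i m" if "m \<in> Poly_Mapping.keys (term_poly t)" for m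
        proof (rule pseudo_eq_expect)
          have "Poly_Mapping.keys m \<subseteq> factors t \<union> cofactors t \<union> B"
            using that lits_term_poly[of t] 2(1) unfolding lits_def by blast
          then have "act_monom m \<subseteq> ?D" by (auto simp: act_monom_def)
          then show "i \<in> A - act_monom m" using i by blast
        qed
        then have "lin pseudo (term_poly t) = lin (expect i) (term_poly t)" by (rule lin_cong)
        also have "0 \<le> \<dots>"
        proof (intro lin_expect_nonneg lin_val_term_nonneg)
          fix g assume "g \<in> hole_maps i"
          then show "0 \<le> lin (val (asg g)) (base t)" using i 2(5)[of i g] by blast
        qed
        finally show ?thesis .
      qed
    qed
  qed
qed

text \<open>Without bad monomials, \<open>pseudo\<close> would be nonnegative on the left side of
  the refutation, yet its value on -1 is negative.\<close>

lemma refutation_has_bad_monomial: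
  assumes "sar_refutation (erphp k n) \<rho>"
  shows "\<exists>t\<in>set \<rho>. \<exists>m\<in>Poly_Mapping.keys (term_poly t). bad m"
proof (rule ccontr)
  assume no: "\<not> ?thesis"
  have valid: "valid_term (erphp k n) t" if "t \<in> set \<rho>" for t
    using assms that by (simp add: sar_refutation_def valid_term_def)
  have "0 \<le> (\<Sum>t\<leftarrow>\<rho>. coefficient t * lin pseudo (term_poly t))"
  proof (rule sum_list_nonneg)
    fix c assume "c \<in> set (map (\<lambda>t. coefficient t * lin pseudo (term_poly t)) \<rho>)"
    then obtain t where t: "t \<in> set \<rho>" "c = coefficient t * lin pseudo (term_poly t)" by auto
    have "0 \<le> lin pseudo (term_poly t)"
      using no t(1) by (intro lin_pseudo_term_nonneg valid) auto
    then show "0 \<le> c" using valid[OF t(1)] t(2) by (simp add: valid_term_def)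
  qed
  also have "\<dots> = lin pseudo (\<Sum>t\<leftarrow>\<rho>. rconst (coefficient t) * term_poly t)"
    by (simp add: lin_sum_list lin_rconst_mult o_def)
  also have "\<dots> = - pseudo 0"
    using assms by (simp add: sar_refutation_def lin_minus lin_one)
  finally have "pseudo 0 \<le> 0" by simp
  moreover have "0 < pseudo 0"
  proof -
    obtain i where i: "i \<in> A" using card_A k by fastforce
    then have "pseudo 0 = real (card (hole_maps i))"
      using pseudo_eq_expect[of i 0] by (simp add: act_monom_def expect_def)
    then show ?thesis using finite_hole_maps hole_maps_nonempty[OF i] by (simp add: card_gt_0_iff)
  qed
  ultimately show False by simp
qed

lemma bad_subset_mentions:
  assumes "bad m"
  shows "A \<subseteq> (\<Union>l\<in>Poly_Mapping.keys m. mentions (lit_var l))"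
  using assms active_subset_mentions by (fastforce simp: bad_def act_monom_def act_def)

lemma bad_fixed:
  assumes "bad m" "l \<in> Poly_Mapping.keys m" "act l = {}"
  shows "asg (\<lambda>_. 0) (lit_var l) \<longleftrightarrow> l = Pos (lit_var l)"
  using assms by (cases l) (auto simp: bad_def fixed_true_def)

lemma bad_hole_literal:
  assumes "bad m" "l \<in> Poly_Mapping.keys m" "lit_var l = Q v w \<or> lit_var l = Z v w" "v \<notin> A"
  shows "v \<in> \<omega> \<longleftrightarrow> l = Pos (lit_var l)"
  using bad_fixed[OF assms(1,2)] assms(3,4) by (auto simp: act_def)

lemma bad_pair_literal:
  assumes "bad m" "l \<in> Poly_Mapping.keys m" "lit_var l = RR v v'" "v \<notin> A \<or> v' \<notin> A"
  shows "(v \<in> A \<or> v \<in> \<omega>) \<noteq> (v' \<in> A \<or> v' \<in> \<omega>) \<longleftrightarrow> l = Pos (lit_var l)"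
  using bad_fixed[OF assms(1,2)] assms(3,4) by (auto simp: act_def bit_def)

end

section \<open>Averaging over the restrictions\<close>

lemma bad_determines:
  assumes l: "l \<in> Poly_Mapping.keys m" "v \<in> mentions (lit_var l)" "v \<notin> A"
  shows "\<exists>u. u \<noteq> v \<and> (\<forall>\<omega> \<omega>'. restriction k n A \<pi> \<longrightarrow> restriction.bad A \<omega> \<pi> m \<longrightarrow>
    restriction.bad A \<omega>' \<pi> m \<longrightarrow> (u \<in> \<omega> \<longleftrightarrow> u \<in> \<omega>') \<longrightarrow> (v \<in> \<omega> \<longleftrightarrow> v \<in> \<omega>'))"
proof -
  consider (hole) w where "lit_var l = Q v w \<or> lit_var l = Z v w"
    | (pair) a b where "lit_var l = RR a b" "a \<noteq> b" "v = a \<or> v = b"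
    using l(2) by (cases "lit_var l") (auto split: if_splits)
  then show ?thesis
  proof cases
    case hole
    have "v \<in> \<omega> \<longleftrightarrow> l = Pos (lit_var l)"
      if "restriction k n A \<pi>" "restriction.bad A \<omega> \<pi> m" for \<omega>
      by (rule restriction.bad_hole_literal[OF that l(1) hole l(3)])
    \<comment> \<open>A literal on \<open>Q\<close> or \<open>Z\<close> fixes the bit of
      \<open>v\<close> outright, so any place other than \<open>v\<close> serves as the
      witness.\<close>
    then show ?thesis by (intro exI[of _ "Suc v"]) simp
  next
    case pair
    have *: "(a \<in> A \<or> a \<in> \<omega>) \<noteq> (b \<in> A \<or> b \<in> \<omega>) \<longleftrightarrow> l = Pos (lit_var l)"
      if "restriction k n A \<pi>" "restriction.bad A \<omega> \<pi> m" for \<omega>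
      using restriction.bad_pair_literal[OF that l(1) pair(1)] pair(3) l(3) by blast
    show ?thesis
    \<comment> \<open>A literal on \<open>RR a b\<close> fixes the exclusive or of two bits, so the
      bit of the other place determines that of \<open>v\<close>.\<close>
    proof (intro exI[of _ "if v = a then b else a"] conjI allI impI)
      show "(if v = a then b else a) \<noteq> v" using pair by auto
      fix \<omega> \<omega>' assume r: "restriction k n A \<pi>" "restriction.bad A \<omega> \<pi> m" "restriction.bad A \<omega>' \<pi> m"
        "(if v = a then b else a) \<in> \<omega> \<longleftrightarrow> (if v = a then b else a) \<in> \<omega>'"
      show "v \<in> \<omega> \<longleftrightarrow> v \<in> \<omega>'"
        using *[OF r(1,2)] *[OF r(1,3)] r(4) pair(3) l(3) by (cases "v = a") auto
    qed
  qed
qed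

text \<open>Any one bijection will do for the pigeons; the counting averages over \<open>A\<close>
  and the bits only.\<close>

definition enum_of :: "nat \<Rightarrow> nat set \<Rightarrow> nat \<Rightarrow> nat" where
  "enum_of k A = (SOME \<pi>. bij_betw \<pi> {1..k} A)"

lemma restriction_enum_of:
  assumes "4 \<le> k" "A \<subseteq> {1..n}" "card A = k"
  shows "restriction k n A (enum_of k A)"
proof
  have "finite A" using assms(2) by (rule finite_subset) simp
  then have "\<exists>\<pi>. bij_betw \<pi> {1..k} A"
    using ex_bij_betw_nat_finite_1 assms(3) by blast
  then show "bij_betw (enum_of k A) {1..k} A"
    unfolding enum_of_def by (rule someI_ex)
qed (use assms in auto)

definition bad_bits :: "nat \<Rightarrow> nat \<Rightarrow> (erphp_var literal \<Rightarrow>\<^sub>0 nat) \<Rightarrow> nat set \<Rightarrow> nat set set" where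
  "bad_bits k n m A = {\<omega> \<in> Pow {1..n}. restriction.bad A \<omega> (enum_of k A) m}"

text \<open>Only sets \<open>A\<close> inside the set \<open>M\<close> of mentioned places
  contribute, and the bit of each place of \<open>M - A\<close> depends on another one by
  \<open>bad_determines\<close>.\<close>

lemma sum_card_bad_bits_le:
  assumes "4 \<le> k"
  shows "real (\<Sum>A | A \<subseteq> {1..n} \<and> card A = k. card (bad_bits k n m A)) * (1 / 4) ^ k \<le> 2 ^ n"
proof -
  define M where "M = {1..n} \<inter> (\<Union>l\<in>Poly_Mapping.keys m. mentions (lit_var l))"
  have empty: "bad_bits k n m A = {}" if "A \<subseteq> {1..n}" "card A = k" "\<not> A \<subseteq> M" for A
  proof -
    have "\<not> restriction.bad A \<omega> (enum_of k A) m" for \<omega>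
      using restriction.bad_subset_mentions[OF restriction_enum_of[OF assms that(1,2)], of \<omega> m]
        that(1,3) by (auto simp: M_def)
    then show ?thesis by (simp add: bad_bits_def)
  qed
  have "(\<Sum>A | A \<subseteq> {1..n} \<and> card A = k. card (bad_bits k n m A)) =
      (\<Sum>A | A \<subseteq> M \<and> card A = k. card (bad_bits k n m A))"
  proof (rule sum.mono_neutral_right)
    show "{A. A \<subseteq> M \<and> card A = k} \<subseteq> {A. A \<subseteq> {1..n} \<and> card A = k}"
      by (auto simp: M_def)
    show "\<forall>A\<in>{A. A \<subseteq> {1..n} \<and> card A = k} - {A. A \<subseteq> M \<and> card A = k}.
        card (bad_bits k n m A) = 0"
    proof
      fix A assume "A \<in> {A. A \<subseteq> {1..n} \<and> card A = k} - {A. A \<subseteq> M \<and> card A = k}"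
      then have "bad_bits k n m A = {}" by (intro empty) auto
      then show "card (bad_bits k n m A) = 0" by simp
    qed
  qed simp
  \<comment> \<open>The choice x = 3/4 satisfies x^2 = 9/16 >= 1/2 and yields the factor 1 - x =
    1/4.\<close>
  moreover have "real (\<Sum>A | A \<subseteq> M \<and> card A = k. card (bad_bits k n m A)) * (1 - 3 / 4) ^ k
      \<le> 2 ^ card {1..n}"
  proof (rule sum_card_supersets_le)
    show "(1::real) / 2 \<le> (3 / 4) ^ 2" by (simp add: power2_eq_square)
    fix A assume A: "A \<subseteq> M" "card A = k"
    have r: "restriction k n A (enum_of k A)"
      using A by (intro restriction_enum_of assms) (auto simp: M_def)
    show "\<exists>w. card (M - A) \<le> 2 * w \<and> card (bad_bits k n m A) * 2 ^ w \<le> 2 ^ card {1..n}"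
    proof (rule card_determined_sets)
      fix v assume "v \<in> M - A"
      then obtain l where l: "l \<in> Poly_Mapping.keys m" "v \<in> mentions (lit_var l)" "v \<notin> A"
        by (auto simp: M_def)
      obtain u where u: "u \<noteq> v" "\<forall>\<omega> \<omega>'. restriction k n A (enum_of k A) \<longrightarrow>
          restriction.bad A \<omega> (enum_of k A) m \<longrightarrow> restriction.bad A \<omega>' (enum_of k A) m \<longrightarrow>
          (u \<in> \<omega> \<longleftrightarrow> u \<in> \<omega>') \<longrightarrow> (v \<in> \<omega> \<longleftrightarrow> v \<in> \<omega>')"
        using bad_determines[OF l, of k n "enum_of k A"] by (elim exE conjE) (rule that)
      show "\<exists>u. u \<noteq> v \<and> (\<forall>\<omega>\<in>bad_bits k n m A. \<forall>\<omega>'\<in>bad_bits k n m A.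
          (u \<in> \<omega> \<longleftrightarrow> u \<in> \<omega>') \<longrightarrow> (v \<in> \<omega> \<longleftrightarrow> v \<in> \<omega>'))"
      proof (intro exI[of _ u] conjI ballI)
        fix \<omega> \<omega>' assume "\<omega> \<in> bad_bits k n m A" "\<omega>' \<in> bad_bits k n m A"
        then have bad: "restriction.bad A \<omega> (enum_of k A) m" "restriction.bad A \<omega>' (enum_of k A) m"
          by (simp_all add: bad_bits_def)
        show "(u \<in> \<omega> \<longleftrightarrow> u \<in> \<omega>') \<longrightarrow> (v \<in> \<omega> \<longleftrightarrow> v \<in> \<omega>')"
          by (rule impI) (rule u(2)[rule_format, OF r bad])
      qed (rule u(1))
    qed (auto simp: M_def bad_bits_def)
  qed (auto simp: M_def)
  ultimately show ?thesis by simp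
qed

lemma card_monomials_le_size:
  "card (\<Union>t\<in>set \<rho>. Poly_Mapping.keys (term_poly t)) \<le> sar_size \<rho>"
proof (induction \<rho>)
  case Nil
  then show ?case by simp
next
  case (Cons t \<rho>)
  have "card (\<Union>t\<in>set (t # \<rho>). Poly_Mapping.keys (term_poly t)) \<le>
      card (Poly_Mapping.keys (term_poly t)) + card (\<Union>t\<in>set \<rho>. Poly_Mapping.keys (term_poly t))"
    by (simp add: card_Un_le)
  then show ?case using Cons by (simp add: sar_size_def num_terms_def)
qed

text \<open>Double counting: each of the (n choose k) 2^n pairs of a set \<open>A\<close> and bits
  \<omega> has a bad monomial in the refutation, while each monomial is bad for at most 4^k 2^n
  pairs.\<close>

lemma erphp_lower_bound:
  assumes "4 \<le> k" "sar_refutation (erphp k n) \<rho>"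
  shows "real (n choose k) * (1 / 4) ^ k \<le> real (sar_size \<rho>)"
proof -
  let ?As = "{A. A \<subseteq> {1..n} \<and> card A = k}"
  define N where "N = (\<Union>t\<in>set \<rho>. Poly_Mapping.keys (term_poly t))"
  have fin: "finite N" by (simp add: N_def)
  have "2 ^ n \<le> (\<Sum>m\<in>N. card (bad_bits k n m A))" if A: "A \<in> ?As" for A
  proof -
    have r: "restriction k n A (enum_of k A)" using A assms(1) by (intro restriction_enum_of) auto
    have "Pow {1..n} \<subseteq> (\<Union>m\<in>N. bad_bits k n m A)"
      using restriction.refutation_has_bad_monomial[OF r assms(2)]
      by (fastforce simp: N_def bad_bits_def)
    then have "card (Pow {1..n}) \<le> card (\<Union>m\<in>N. bad_bits k n m A)"
      using fin by (intro card_mono) (auto simp: bad_bits_def)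
    also have "\<dots> \<le> (\<Sum>m\<in>N. card (bad_bits k n m A))" by (rule card_UN_le[OF fin])
    finally show ?thesis by (simp add: card_Pow)
  qed
  then have "(\<Sum>A\<in>?As. 2 ^ n) \<le> (\<Sum>A\<in>?As. \<Sum>m\<in>N. card (bad_bits k n m A))"
    by (rule sum_mono)
  also have "\<dots> = (\<Sum>m\<in>N. \<Sum>A\<in>?As. card (bad_bits k n m A))" by (rule sum.swap)
  finally have "(n choose k) * 2 ^ n \<le> (\<Sum>m\<in>N. \<Sum>A\<in>?As. card (bad_bits k n m A))"
    by (simp add: n_subsets)
  then have "real ((n choose k) * 2 ^ n) \<le> real (\<Sum>m\<in>N. \<Sum>A\<in>?As. card (bad_bits k n m A))"
    by (rule of_nat_mono)
  then have "real ((n choose k) * 2 ^ n) * (1 / 4) ^ k \<le>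
      real (\<Sum>m\<in>N. \<Sum>A\<in>?As. card (bad_bits k n m A)) * (1 / 4) ^ k"
    by (rule mult_right_mono) simp
  also have "\<dots> = (\<Sum>m\<in>N. real (\<Sum>A\<in>?As. card (bad_bits k n m A)) * (1 / 4) ^ k)"
    by (simp only: of_nat_sum sum_distrib_right)
  also have "\<dots> \<le> (\<Sum>m\<in>N. 2 ^ n)"
    by (intro sum_mono sum_card_bad_bits_le assms(1))
  also have "\<dots> = real (card N) * 2 ^ n" by simp
  finally have "(real (n choose k) * (1 / 4) ^ k) * 2 ^ n \<le> real (card N) * 2 ^ n"
    by (simp add: mult_ac)
  then have "real (n choose k) * (1 / 4) ^ k \<le> real (card N)" by simp
  also have "\<dots> \<le> real (sar_size \<rho>)" using card_monomials_le_size[of \<rho>] by (simp add: N_def)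
  finally show ?thesis .
qed

section \<open>The two asymptotic bounds\<close>

theorem theorem4p10:
  fixes k :: "nat \<Rightarrow> nat"
  assumes "\<forall>\<^sub>F n in sequentially. real (k n) \<le> real n / (4 * log 2 (real n))"
  shows "(\<exists>C::real>0. \<forall>\<^sub>F n in sequentially. 4 \<le> k n \<longrightarrow>
            (\<exists>\<pi>. sar_refutation (erphp (k n) n) \<pi> \<and>
                 real (sar_size \<pi>) \<le> C * (real (k n) ^ (k n + 2) * real n ^ k n)))
       \<and> (\<exists>c::real>0. \<forall>\<^sub>F n in sequentially. 4 \<le> k n \<longrightarrow>
            (\<forall>\<pi>. sar_refutation (erphp (k n) n) \<pi> \<longrightarrow>
                 real (sar_size \<pi>) \<ge>
                   c * (real n ^ k n / (4 * real (k n) * log 2 (real n)) ^ k n)))"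
proof (intro conjI)
  have "\<exists>\<pi>. sar_refutation (erphp (k n) n) \<pi> \<and>
      real (sar_size \<pi>) \<le> 141 * (real (k n) ^ (k n + 2) * real n ^ k n)" if n: "4 \<le> n" "4 \<le> k n" for n
  proof -
    obtain \<pi> where \<pi>: "sar_refutation (erphp (k n) n) \<pi>" "sar_size \<pi> \<le> 141 * (n * k n) ^ k n"
      using erphp_upper_bound[OF n(2,1)] by blast
    have "real (sar_size \<pi>) \<le> 141 * (real n * real (k n)) ^ k n"
      using of_nat_mono[OF \<pi>(2), where 'a = real] by simp
    also have "\<dots> = 141 * (real (k n) ^ k n * real n ^ k n)" by (simp add: power_mult_distrib)
    also have "\<dots> \<le> 141 * (real (k n) ^ (k n + 2) * real n ^ k n)"
      using n(2) by (intro mult_left_mono mult_right_mono power_increasing) auto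
    finally show ?thesis using \<pi>(1) by blast
  qed
  then show "\<exists>C::real>0. \<forall>\<^sub>F n in sequentially. 4 \<le> k n \<longrightarrow>
      (\<exists>\<pi>. sar_refutation (erphp (k n) n) \<pi> \<and>
        real (sar_size \<pi>) \<le> C * (real (k n) ^ (k n + 2) * real n ^ k n))"
    by (intro exI[of _ 141]) (auto intro!: eventually_mono[OF eventually_ge_at_top[of 4]])
next
  have "real n ^ k n / (4 * real (k n) * log 2 (real n)) ^ k n \<le> real (sar_size \<pi>)"
    if n: "2 \<le> n" "real (k n) \<le> real n / (4 * log 2 (real n))" "4 \<le> k n"
      and \<pi>: "sar_refutation (erphp (k n) n) \<pi>" for n \<pi>
  proof -
    \<comment> \<open>The logarithm being at least 1 gives \<open>k n \<le> n\<close>, which (n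
      choose k) >= (n/k)^k requires, and lets the denominator (4 k log n)^k be lowered to (4
      k)^k.\<close>
    have log: "1 \<le> log 2 (real n)" using n(1) by (simp add: le_log_iff)
    have "real n / (4 * log 2 (real n)) \<le> real n / 1" using log by (intro divide_left_mono) auto
    then have kn: "k n \<le> n" using n(2) by simp
    have "real n ^ k n / (4 * real (k n) * log 2 (real n)) ^ k n \<le> real n ^ k n / (4 * real (k n)) ^ k n"
      using n(3) log mult_left_mono[OF log, of "4 * real (k n)"]
      by (intro divide_left_mono power_mono mult_pos_pos zero_less_power) auto
    also have "\<dots> = (real n / real (k n)) ^ k n * (1 / 4) ^ k n"
      by (simp add: power_divide power_mult_distrib)
    also have "\<dots> \<le> real (n choose k n) * (1 / 4) ^ k n"
      using binomial_ge_n_over_k_pow_k[OF kn, where 'a = real] by (intro mult_right_mono) auto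
    also have "\<dots> \<le> real (sar_size \<pi>)" by (rule erphp_lower_bound[OF n(3) \<pi>])
    finally show ?thesis .
  qed
  then show "\<exists>c::real>0. \<forall>\<^sub>F n in sequentially. 4 \<le> k n \<longrightarrow>
      (\<forall>\<pi>. sar_refutation (erphp (k n) n) \<pi> \<longrightarrow>
        real (sar_size \<pi>) \<ge> c * (real n ^ k n / (4 * real (k n) * log 2 (real n)) ^ k n))"
    by (intro exI[of _ 1])
       (auto intro!: eventually_mono[OF eventually_conj[OF eventually_ge_at_top[of 2] assms]])
qed

end
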